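(* Let $\mathcal{D}$ be a domain in $\mathbb{C}^{2n}_*$ and let $\{\mathcal{D}_\alpha\}_{\alpha\in\mathfrak{A}}$ be a finite open covering of $\mathcal{D}$. Let $\{F_\alpha(\boldsymbol{t})\}_{\alpha\in\mathfrak{A}}$ and $\{G_\alpha(\boldsymbol{t})\}_{\alpha\in\mathfrak{A}}$ be collections of, respectively, $\mathbb{C}^{m\times n}$-valued and $\mathbb{C}^{n\times m}$-valued functions satisfying the following conditions: 1. For each $\alpha\in\mathfrak{A}$ the functions $F_\alpha(\boldsymbol{t})$, $G_\alpha(\boldsymbol{t})$ are holomorphic in $\mathcal{D}_\alpha$. 2. Whenever $\mathcal{D}_{\alpha'}\cap\mathcal{D}_{\alpha''}\neq\emptyset$, there exist diagonal matrix functions $D_{r,\alpha',\alpha''}(\boldsymbol{t})$, $D_{c,\alpha',\alpha''}(\boldsymbol{t})$, holomorphic and invertible in $\mathcal{D}_{\alpha'}\cap\mathcal{D}_{\alpha''}$, such that for every $\boldsymbol{t}\in\mathcal{D}_{\alpha'}\cap\mathcal{D}_{\alpha''}$ $$F_{\alpha''}(\boldsymbol{t})=F_{\alpha'}(\boldsymbol{t})D_{c,\alpha',\alpha''}(\boldsymbol{t}),\qquad G_{\alpha''}(\boldsymbol{t})=D_{r,\alpha',\alpha''}(\boldsymbol{t})G_{\alpha'}(\boldsymbol{t}).$$ 3. The pair of collections $\{F_\alpha\}_{\alpha\in\mathfrak{A}}$, $\{G_\alpha\}_{\alpha\in\mathfrak{A}}$ is $\mathcal{PZ}$-admissible. Let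 $\{S_\alpha(\boldsymbol{t})\}_{\alpha\in\mathfrak{A}}$ be the collection of $\mathcal{PZ}$-coupling functions and $\Gamma_{\mathcal{PZ}}$ the $\mathcal{PZ}$-singular set related to this pair of collections. Then there exists a unique normalized holomorphic family $\{R(z,\boldsymbol{t})\}_{\boldsymbol{t}\in\mathcal{D}\setminus\Gamma_{\mathcal{PZ}}}$ of generic rational functions parameterized by the pole and zero loci such that for every $\alpha\in\mathfrak{A}$ and $\boldsymbol{t}\in\mathcal{D}_\alpha\setminus\Gamma_{\mathcal{PZ}}$ the matrices $F_\alpha(\boldsymbol{t})$ and $G_\alpha(\boldsymbol{t})$ are, respectively, the left zero and right pole semiresidual matrices of $R(\cdot,\boldsymbol{t})$. It is locally given by $$R(z,\boldsymbol{t})=I+F_\alpha(\boldsymbol{t})S_\alpha^{-1}(\boldsymbol{t})(zI-A_{\mathcal P}(\boldsymbol{t}))^{-1}G_\alpha(\boldsymbol{t}),\qquad \boldsymbol{t}\in\mathcal{D}_\alpha\setminus\Gamma_{\mathcal{PZ}}.$$ Furthermore, the logarithmic derivative of $R(z,\boldsymbol{t})$ with respect to $z$ admits the local representation $$\frac{\partial R(z,\boldsymbol{t})}{\partial z}R^{-1}(z,\boldsymbol{t})=-F_\alpha(\boldsymbol{t})S_\alpha^{-1}(\boldsymbol{t})(zI-A_{\mathcal P}(\boldsymbol{t}))^{-1}S_\alpha(\boldsymbol{t})(zI-A_{\mathcal Z}(\boldsymbol{t}))^{-1}S_\alpha^{-1}(\boldsymbol{t})G_\alpha(\boldsymbol{t}),\qquad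 \boldsymbol{t}\in\mathcal{D}_\alpha\setminus\Gamma_{\mathcal{PZ}}.$$
   Context: $\mathbb{C}^{2n}_*$ is the set of $\boldsymbol{t}=(t_1,\dots,t_{2n})\in\mathbb{C}^{2n}$ with pairwise distinct coordinates; $A_{\mathcal P}(\boldsymbol{t})=\mathrm{diag}(t_1,\dots,t_n)$, $A_{\mathcal Z}(\boldsymbol{t})=\mathrm{diag}(t_{n+1},\dots,t_{2n})$. Coupling functions. For $\alpha\in\mathfrak{A}$, $\boldsymbol{t}\in\mathcal{D}_\alpha$, the $\mathcal{PZ}$-coupling function $S_\alpha(\boldsymbol{t})\in\mathbb{C}^{n\times n}$ is the unique solution of the Lyapunov equation $A_{\mathcal P}(\boldsymbol{t})S_\alpha(\boldsymbol{t})-S_\alpha(\boldsymbol{t})A_{\mathcal Z}(\boldsymbol{t})=G_\alpha(\boldsymbol{t})F_\alpha(\boldsymbol{t})$; it is holomorphic in $\mathcal{D}_\alpha$. The pair of collections is $\mathcal{PZ}$-admissible if for every $\alpha\in\mathfrak{A}$, $\det S_\alpha(\boldsymbol{t})\not\equiv0$ in $\mathcal{D}_\alpha$; in that case the $\mathcal{PZ}$-singular set is $\Gamma_{\mathcal{PZ}}=\bigcup_{\alpha\in\mathfrak{A}}\{\boldsymbol{t}\in\mathcal{D}_\alpha:\det S_\alpha(\boldsymbol{t})=0\}$. Simple singular points. Let $R(z)$ be a $\mathbb{C}^{m\times m}$-valued function, holomorphic and invertible in a punctured neighborhood of $t\in\mathbb{C}$. The point $t$ is regular for $R$ if $R$ and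 $R^{-1}$ are both holomorphic at $t$, and singular otherwise. A singular point $t$ is simple if either $R$ has a simple pole at $t$ and $R^{-1}$ is holomorphic at $t$ (then $t$ is a pole of $R$), or $R^{-1}$ has a simple pole at $t$ and $R$ is holomorphic at $t$ (then $t$ is a zero of $R$). Generic rational functions. A $\mathbb{C}^{m\times m}$-valued rational function $R$ is generic if $\det R\not\equiv0$, all its singular points in $\mathbb{C}$ are simple, $\infty$ is a regular point ($R$ and $R^{-1}$ holomorphic at $\infty$), and all residues of $R$ and $R^{-1}$ at their poles have rank one. Such $R$ has equally many poles and zeros; order the poles as $t_1,\dots,t_n$ and the zeros as $t_{n+1},\dots,t_{2n}$. The pole and zero matrices are $\mathrm{diag}(t_1,\dots,t_n)$ and $\mathrm{diag}(t_{n+1},\dots,t_{2n})$. Let $R_k$ be the residue at $t_k$ of $R$ (for $1\le k\le n$), respectively of $R^{-1}$ (for $n+1\le k\le 2n$), and factor $R_k=f_kg_k$ with $f_k\in\mathbb{C}^{m\times1}$, $g_k\in\mathbb{C}^{1\times m}$ (unique up to $f_k\to f_kc$, $g_k\to c^{-1}g_k$, $c\neq0$). A matrix with columns $f_{n+1},\dots,f_{2n}$ is a left zero semiresidual matrix of $R$; a matrix with rows $g_1,\dots,g_n$ is a right pole semiresidual matrix of $R$. "$F$ is the left zero semiresidual matrix of $R$" means that $F$ arises for some choice of the factorizations; similarly for the right pole one. Families. Let $\mathcal{D}'\subseteq\mathbb{C}^{2n}_*$ be a domain. A normalized holomorphic family of generic rational functions parameterized by the pole and zero loci is a family $\{R(z,\boldsymbol{t})\}_{\boldsymbol{t}\in\mathcal{D}'}$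 such that: for each $\boldsymbol{t}\in\mathcal{D}'$, $R(\cdot,\boldsymbol{t})$ is a generic $\mathbb{C}^{m\times m}$-valued rational function with pole and zero matrices $A_{\mathcal P}(\boldsymbol{t})$, $A_{\mathcal Z}(\boldsymbol{t})$; for each $\boldsymbol{t}^0\in\mathcal{D}'$ and each fixed $z\in\mathbb{C}\setminus\{t_1^0,\dots,t_{2n}^0\}$, $R(z,\boldsymbol{t})$ is holomorphic in $\boldsymbol{t}$ in a neighborhood of $\boldsymbol{t}^0$; and $R(\infty,\boldsymbol{t})\equiv I$. *)

theory Defs
  imports "HOL-Complex_Analysis.Complex_Analysis"
begin

text \<open>
  A point \<open>t\<close> of \<open>\<complex>\<^sup>2\<^sup>n\<close> is an element of \<^typ>\<open>complex ^ ('n::finite + 'n)\<close>: its first \<open>n\<close>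
  coordinates (the poles) are \<open>t $ Inl k\<close>, its last \<open>n\<close> coordinates (the zeros) are
  \<open>t $ Inr k\<close>.
\<close>

definition diag_mat :: "('n \<Rightarrow> complex) \<Rightarrow> complex ^ 'n ^ 'n" where
  "diag_mat d = (\<chi> i j. if i = j then d i else 0)"

definition diagonal_mat :: "complex ^ 'n ^ 'n \<Rightarrow> bool" where
  "diagonal_mat A \<longleftrightarrow> (\<forall>i j. i \<noteq> j \<longrightarrow> A $ i $ j = 0)"

definition col_times_row :: "complex ^ 'm \<Rightarrow> complex ^ 'n \<Rightarrow> complex ^ 'n ^ 'm" where
  "col_times_row f g = (\<chi> i j. f $ i * g $ j)"

text \<open>Holomorphy on an open set: Frechet differentiability with a complex linear derivative.\<close>

definition holomorphic_several_on ::
    "(complex ^ 'k \<Rightarrow> complex) \<Rightarrow> (complex ^ 'k) set \<Rightarrow> bool" where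
  "holomorphic_several_on f U \<longleftrightarrow> open U \<and>
     (\<forall>t\<in>U. \<exists>f'. (f has_derivative f') (at t) \<and> (\<forall>c v. f' (c *s v) = c * f' v))"

definition mat_holomorphic_on ::
    "(complex ^ 'k \<Rightarrow> complex ^ 'b ^ 'a) \<Rightarrow> (complex ^ 'k) set \<Rightarrow> bool" where
  "mat_holomorphic_on M U \<longleftrightarrow> (\<forall>i j. holomorphic_several_on (\<lambda>t. M t $ i $ j) U)"

definition is_domain :: "'a::topological_space set \<Rightarrow> bool" where
  "is_domain U \<longleftrightarrow> open U \<and> connected U \<and> U \<noteq> {}"

definition distinct_coords :: "(complex ^ 'k) set" where
  "distinct_coords = {t. inj (($) t)}"

definition A_P :: "complex ^ ('n::finite + 'n) \<Rightarrow> complex ^ 'n ^ 'n" where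
  "A_P t = diag_mat (\<lambda>k. t $ Inl k)"

definition A_Z :: "complex ^ ('n::finite + 'n) \<Rightarrow> complex ^ 'n ^ 'n" where
  "A_Z t = diag_mat (\<lambda>k. t $ Inr k)"

text \<open>
  A matrix function is a total function whose values at its isolated singularities carry no
  meaning. Hence holomorphy at \<open>t\<close>, like all local notions below, is a property of its germ on
  punctured neighbourhoods of \<open>t\<close>: the function extends holomorphically to \<open>t\<close>.
\<close>

definition mat_holomorphic_at :: "(complex \<Rightarrow> complex ^ 'b ^ 'a) \<Rightarrow> complex \<Rightarrow> bool" where
  "mat_holomorphic_at R t \<longleftrightarrow>
     (\<forall>i j. \<exists>h. h analytic_on {t} \<and> (\<forall>\<^sub>F z in at t. R z $ i $ j = h z))"

definition mat_simple_pole :: "(complex \<Rightarrow> complex ^ 'b ^ 'a) \<Rightarrow> complex \<Rightarrow> bool" where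
  "mat_simple_pole R t \<longleftrightarrow> \<not> mat_holomorphic_at R t \<and>
     mat_holomorphic_at (\<lambda>z. \<chi> i j. (z - t) * R z $ i $ j) t"

definition mat_residue :: "(complex \<Rightarrow> complex ^ 'b ^ 'a) \<Rightarrow> complex \<Rightarrow> complex ^ 'b ^ 'a" where
  "mat_residue R t = (\<chi> i j. residue (\<lambda>z. R z $ i $ j) t)"

definition mat_deriv :: "(complex \<Rightarrow> complex ^ 'b ^ 'a) \<Rightarrow> complex \<Rightarrow> complex ^ 'b ^ 'a" where
  "mat_deriv R z = (\<chi> i j. deriv (\<lambda>w. R w $ i $ j) z)"

definition inv_fun :: "(complex \<Rightarrow> complex ^ 'm ^ 'm) \<Rightarrow> complex \<Rightarrow> complex ^ 'm ^ 'm" where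
  "inv_fun R = (\<lambda>z. matrix_inv (R z))"

definition regular_point :: "(complex \<Rightarrow> complex ^ 'm ^ 'm) \<Rightarrow> complex \<Rightarrow> bool" where
  "regular_point R t \<longleftrightarrow> mat_holomorphic_at R t \<and> mat_holomorphic_at (inv_fun R) t"

definition regular_at_infinity :: "(complex \<Rightarrow> complex ^ 'm ^ 'm) \<Rightarrow> bool" where
  "regular_at_infinity R \<longleftrightarrow> regular_point (\<lambda>w. R (1 / w)) 0"

definition simple_pole_point :: "(complex \<Rightarrow> complex ^ 'm ^ 'm) \<Rightarrow> complex \<Rightarrow> bool" where
  "simple_pole_point R t \<longleftrightarrow> mat_simple_pole R t \<and> mat_holomorphic_at (inv_fun R) t"

definition simple_zero_point :: "(complex \<Rightarrow> complex ^ 'm ^ 'm) \<Rightarrow> complex \<Rightarrow> bool" where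
  "simple_zero_point R t \<longleftrightarrow> mat_simple_pole (inv_fun R) t \<and> mat_holomorphic_at R t"

text \<open>
  The fraction is in lowest terms, so its value is prescribed at every point except the genuine
  poles; in particular there are no removable singularities with a wrong value.
\<close>

definition rational_fun :: "(complex \<Rightarrow> complex) \<Rightarrow> bool" where
  "rational_fun f \<longleftrightarrow>
     (\<exists>p q. q \<noteq> 0 \<and> coprime p q \<and> (\<forall>z. poly q z \<noteq> 0 \<longrightarrow> f z = poly p z / poly q z))"

definition mat_rational :: "(complex \<Rightarrow> complex ^ 'b ^ 'a) \<Rightarrow> bool" where
  "mat_rational R \<longleftrightarrow> (\<forall>i j. rational_fun (\<lambda>z. R z $ i $ j))"

text \<open>
  In the second conjunct (\<open>det R\<close> does not vanish identically) the holomorphy of \<open>R\<close> at \<open>z\<close>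
  excludes the meaningless values at poles.
\<close>

definition generic_rational :: "(complex \<Rightarrow> complex ^ 'm ^ 'm) \<Rightarrow> bool" where
  "generic_rational R \<longleftrightarrow>
     mat_rational R \<and>
     (\<exists>z. mat_holomorphic_at R z \<and> det (R z) \<noteq> 0) \<and>
     (\<forall>t. \<not> regular_point R t \<longrightarrow> simple_pole_point R t \<or> simple_zero_point R t) \<and>
     regular_at_infinity R \<and>
     (\<forall>t. simple_pole_point R t \<longrightarrow> rank (mat_residue R t) = 1) \<and>
     (\<forall>t. simple_zero_point R t \<longrightarrow> rank (mat_residue (inv_fun R) t) = 1)"

text \<open>The matrix is \<open>diag(t\<^sub>1, \<dots>, t\<^sub>n)\<close> for an enumeration without repetition of all poles (zeros).\<close>

definition pole_matrix :: "(complex \<Rightarrow> complex ^ 'm ^ 'm) \<Rightarrow> complex ^ 'n ^ 'n \<Rightarrow> bool" where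
  "pole_matrix R A \<longleftrightarrow> (\<exists>d. inj d \<and> range d = {z. simple_pole_point R z} \<and> A = diag_mat d)"

definition zero_matrix :: "(complex \<Rightarrow> complex ^ 'm ^ 'm) \<Rightarrow> complex ^ 'n ^ 'n \<Rightarrow> bool" where
  "zero_matrix R A \<longleftrightarrow> (\<exists>d. inj d \<and> range d = {z. simple_zero_point R z} \<and> A = diag_mat d)"

text \<open>
  Semiresidual matrices depend on the order of the poles and zeros, which is given by \<open>t\<close>. The
  columns of \<open>F\<close> (rows of \<open>G\<close>) are the left (right) factors in some factorizations of the residues.
\<close>

definition left_zero_semiresidual ::
    "(complex \<Rightarrow> complex ^ 'm ^ 'm) \<Rightarrow> complex ^ ('n::finite + 'n) \<Rightarrow> complex ^ 'n ^ 'm \<Rightarrow> bool" where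
  "left_zero_semiresidual R t F \<longleftrightarrow>
     (\<forall>k. \<exists>g. mat_residue (inv_fun R) (t $ Inr k) = col_times_row (column k F) g)"

definition right_pole_semiresidual ::
    "(complex \<Rightarrow> complex ^ 'm ^ 'm) \<Rightarrow> complex ^ ('n::finite + 'n) \<Rightarrow> complex ^ 'm ^ 'n \<Rightarrow> bool" where
  "right_pole_semiresidual R t G \<longleftrightarrow>
     (\<forall>k. \<exists>f. mat_residue R (t $ Inl k) = col_times_row f (row k G))"

text \<open>A family is written \<open>R z t\<close>; its values for \<open>t \<notin> D\<close> are irrelevant.\<close>

definition normalized_holomorphic_family ::
    "(complex ^ ('n::finite + 'n)) set \<Rightarrow>
     (complex \<Rightarrow> complex ^ ('n + 'n) \<Rightarrow> complex ^ 'm ^ 'm) \<Rightarrow> bool" where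
  "normalized_holomorphic_family D R \<longleftrightarrow>
     is_domain D \<and> D \<subseteq> distinct_coords \<and>
     (\<forall>t\<in>D. generic_rational (\<lambda>z. R z t) \<and>
        pole_matrix (\<lambda>z. R z t) (A_P t) \<and> zero_matrix (\<lambda>z. R z t) (A_Z t)) \<and>
     (\<forall>t0\<in>D. \<forall>z. z \<notin> range (($) t0) \<longrightarrow>
        (\<exists>U. t0 \<in> U \<and> U \<subseteq> D \<and> mat_holomorphic_on (R z) U)) \<and>
     (\<forall>t\<in>D. ((\<lambda>z. R z t) \<longlongrightarrow> mat 1) at_infinity)"

definition coupling ::
    "complex ^ ('n::finite + 'n) \<Rightarrow> complex ^ 'n ^ 'm \<Rightarrow> complex ^ 'm ^ 'n \<Rightarrow> complex ^ 'n ^ 'n" where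
  "coupling t F G = (THE S. A_P t ** S - S ** A_Z t = G ** F)"

definition PZ_admissible ::
    "'a set \<Rightarrow> ('a \<Rightarrow> (complex ^ ('n::finite + 'n)) set) \<Rightarrow>
     ('a \<Rightarrow> complex ^ ('n + 'n) \<Rightarrow> complex ^ 'n ^ 'm) \<Rightarrow>
     ('a \<Rightarrow> complex ^ ('n + 'n) \<Rightarrow> complex ^ 'm ^ 'n) \<Rightarrow> bool" where
  "PZ_admissible I U F G \<longleftrightarrow> (\<forall>\<alpha>\<in>I. \<exists>t\<in>U \<alpha>. det (coupling t (F \<alpha> t) (G \<alpha> t)) \<noteq> 0)"

definition PZ_singular_set ::
    "'a set \<Rightarrow> ('a \<Rightarrow> (complex ^ ('n::finite + 'n)) set) \<Rightarrow>
     ('a \<Rightarrow> complex ^ ('n + 'n) \<Rightarrow> complex ^ 'n ^ 'm) \<Rightarrow>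
     ('a \<Rightarrow> complex ^ ('n + 'n) \<Rightarrow> complex ^ 'm ^ 'n) \<Rightarrow> (complex ^ ('n + 'n)) set" where
  "PZ_singular_set I U F G = (\<Union>\<alpha>\<in>I. {t \<in> U \<alpha>. det (coupling t (F \<alpha> t) (G \<alpha> t)) = 0})"

definition has_semiresiduals ::
    "'a set \<Rightarrow> ('a \<Rightarrow> (complex ^ ('n::finite + 'n)) set) \<Rightarrow>
     ('a \<Rightarrow> complex ^ ('n + 'n) \<Rightarrow> complex ^ 'n ^ 'm) \<Rightarrow>
     ('a \<Rightarrow> complex ^ ('n + 'n) \<Rightarrow> complex ^ 'm ^ 'n) \<Rightarrow>
     (complex \<Rightarrow> complex ^ ('n + 'n) \<Rightarrow> complex ^ 'm ^ 'm) \<Rightarrow> bool" where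
  "has_semiresiduals I U F G R \<longleftrightarrow>
     (\<forall>\<alpha>\<in>I. \<forall>t\<in>U \<alpha> - PZ_singular_set I U F G.
        left_zero_semiresidual (\<lambda>z. R z t) t (F \<alpha> t) \<and>
        right_pole_semiresidual (\<lambda>z. R z t) t (G \<alpha> t))"

end

theory Submission
  imports Defs "HOL-Computational_Algebra.Fundamental_Theorem_Algebra"
begin

text \<open>
  For a fixed \<open>t\<close> write \<open>p\<close> and \<open>q\<close> for the poles and zeros and
  \<open>P = (z I - A\<^sub>P)\<^sup>-\<^sup>1\<close>, \<open>Q = (z I - A\<^sub>Z)\<^sup>-\<^sup>1\<close>. Multiplying the Lyapunov equation
  \<open>A\<^sub>P S - S A\<^sub>Z = G F\<close> by \<open>P\<close> from the left and by \<open>Q\<close> from the right turns it into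
  \<open>P G F Q = P S - S Q\<close> (\<open>resolvent_identity\<close>). This one identity says that
  \<open>R = I + F S\<^sup>-\<^sup>1 P G\<close> has the inverse \<open>I - F Q S\<^sup>-\<^sup>1 G\<close>, and it also gives the formula for
  \<open>R' R\<^sup>-\<^sup>1\<close>. So \<open>R\<close> and its inverse are both sums of simple fractions with residues of rank at
  most one, from which the semiresidual matrices can be read off. The residues do not vanish:
  a zero column of \<open>F\<close> or a zero row of \<open>G\<close> would, through the Lyapunov equation, produce a zero
  column or row of the invertible matrix \<open>S\<close>. The remaining factors \<open>F S\<^sup>-\<^sup>1\<close> and \<open>S\<^sup>-\<^sup>1 G\<close> are covered
  by the same argument, because the inverse function solves the same problem with the roles of
  poles and zeros exchanged and \<open>S\<close> replaced by \<open>- S\<^sup>-\<^sup>1\<close> (\<open>dual\<close>).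

  Conversely, let \<open>R\<close> be a generic function with these poles, zeros and semiresidual matrices and
  with \<open>R(\<infinity>) = I\<close>. By Liouville's theorem \<open>R = I + C P G\<close> for some matrix \<open>C\<close>
  (\<open>rational_fun_eq_partial_fraction\<close>). At a zero \<open>q\<^sub>k\<close> the product \<open>R R\<^sup>-\<^sup>1 = I\<close> has no pole, hence
  \<open>R(q\<^sub>k)\<close> annihilates the residue of \<open>R\<^sup>-\<^sup>1\<close>, that is, the \<open>k\<close>-th column of \<open>F\<close>. In terms of \<open>S\<close>
  these equations read \<open>F = C S\<close>, which determines \<open>C\<close> (\<open>R_unique\<close>). Rescaling the columns of \<open>F\<close>
  and the rows of \<open>G\<close> by nonzero factors does not change the factorizability of the residues, so this uniqueness also
  makes the local formulas agree on overlaps and yields a single family.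

  The family depends holomorphically on \<open>t\<close> because \<open>S\<close> is given by an explicit formula and
  \<open>S\<^sup>-\<^sup>1\<close> by Cramer's rule. Finally its parameter set has to be a domain. On overlaps the
  determinants of the coupling functions differ by nonvanishing factors, so the singular set is
  locally the zero set of a single holomorphic function; the
  complement of such a set in a domain is again connected as soon as it is nonempty
  (\<open>is_domain_diff_analytic_hypersurface\<close>). Inside a ball this is seen by joining two points by
  a complex line, on which the zeros are countable.
\<close>

section \<open>Holomorphic functions of several variables\<close>

lemma holomorphic_several_on_subset:
  assumes "holomorphic_several_on f U" "V \<subseteq> U" "open V"
  shows "holomorphic_several_on f V"
  using assms unfolding holomorphic_several_on_def by blast

lemma holomorphic_several_on_cong:
  assumes "holomorphic_several_on f U" "\<And>t. t \<in> U \<Longrightarrow> g t = f t"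
  shows "holomorphic_several_on g U"
proof -
  have "open U" using assms(1) unfolding holomorphic_several_on_def by blast
  have "\<exists>g'. (g has_derivative g') (at t) \<and> (\<forall>c v. g' (c *s v) = c * g' v)" if "t \<in> U" for t
  proof -
    obtain f' where f': "(f has_derivative f') (at t)" "\<forall>c v. f' (c *s v) = c * f' v"
      using assms(1) \<open>t \<in> U\<close> unfolding holomorphic_several_on_def by blast
    have "(g has_derivative f') (at t)"
      by (rule has_derivative_transform_within_open[OF f'(1) \<open>open U\<close> \<open>t \<in> U\<close>]) (simp add: assms(2))
    with f'(2) show ?thesis by blast
  qed
  with \<open>open U\<close> show ?thesis unfolding holomorphic_several_on_def by blast
qed

lemma holomorphic_several_on_imp_continuous_on:
  assumes "holomorphic_several_on f U"
  shows "continuous_on U f"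
proof (rule continuous_at_imp_continuous_on, rule ballI)
  fix t assume "t \<in> U"
  then obtain f' where "(f has_derivative f') (at t)"
    using assms unfolding holomorphic_several_on_def by blast
  then show "continuous (at t) f" by (rule has_derivative_continuous)
qed

lemma holomorphic_several_on_const: "open U \<Longrightarrow> holomorphic_several_on (\<lambda>t. c) U"
  unfolding holomorphic_several_on_def by (auto intro!: exI[of _ "\<lambda>_. 0"])

lemma holomorphic_several_on_coord: "open U \<Longrightarrow> holomorphic_several_on (\<lambda>t. t $ k) U"
  unfolding holomorphic_several_on_def
  by (auto intro!: exI[of _ "\<lambda>v. v $ k"] bounded_linear_imp_has_derivative bounded_linear_vec_nth)

lemma holomorphic_several_on_add:
  assumes "holomorphic_several_on f U" "holomorphic_several_on g U"
  shows "holomorphic_several_on (\<lambda>t. f t + g t) U"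
  unfolding holomorphic_several_on_def
proof safe
  show "open U" using assms(1) unfolding holomorphic_several_on_def by blast
  fix t assume "t \<in> U"
  then obtain f' g' where
    "(f has_derivative f') (at t)" "\<forall>c v. f' (c *s v) = c * f' v"
    "(g has_derivative g') (at t)" "\<forall>c v. g' (c *s v) = c * g' v"
    using assms unfolding holomorphic_several_on_def by metis
  then show "\<exists>h. ((\<lambda>t. f t + g t) has_derivative h) (at t) \<and> (\<forall>c v. h (c *s v) = c * h v)"
    by (intro exI[of _ "\<lambda>v. f' v + g' v"]) (auto intro: has_derivative_add simp: algebra_simps)
qed

lemma holomorphic_several_on_mult:
  assumes "holomorphic_several_on f U" "holomorphic_several_on g U"
  shows "holomorphic_several_on (\<lambda>t. f t * g t) U"
  unfolding holomorphic_several_on_def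
proof safe
  show "open U" using assms(1) unfolding holomorphic_several_on_def by blast
  fix t assume "t \<in> U"
  then obtain f' g' where
    "(f has_derivative f') (at t)" "\<forall>c v. f' (c *s v) = c * f' v"
    "(g has_derivative g') (at t)" "\<forall>c v. g' (c *s v) = c * g' v"
    using assms unfolding holomorphic_several_on_def by metis
  then show "\<exists>h. ((\<lambda>t. f t * g t) has_derivative h) (at t) \<and> (\<forall>c v. h (c *s v) = c * h v)"
    by (intro exI[of _ "\<lambda>v. f t * g' v + f' v * g t"])
       (auto intro: has_derivative_mult simp: algebra_simps)
qed

lemma holomorphic_several_on_inverse:
  assumes "holomorphic_several_on f U" "\<And>t. t \<in> U \<Longrightarrow> f t \<noteq> 0"
  shows "holomorphic_several_on (\<lambda>t. inverse (f t)) U"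
  unfolding holomorphic_several_on_def
proof safe
  show "open U" using assms(1) unfolding holomorphic_several_on_def by blast
  fix t assume "t \<in> U"
  then obtain f' where
    f': "(f has_derivative f') (at t)" "\<forall>c v. f' (c *s v) = c * f' v"
    using assms unfolding holomorphic_several_on_def by metis
  show "\<exists>h. ((\<lambda>t. inverse (f t)) has_derivative h) (at t) \<and> (\<forall>c v. h (c *s v) = c * h v)"
    using Deriv.has_derivative_inverse[OF assms(2)[OF \<open>t \<in> U\<close>] f'(1)] f'(2)
    by (intro exI[of _ "\<lambda>h. - (inverse (f t) * f' h * inverse (f t))"]) (auto simp: algebra_simps)
qed

lemma holomorphic_several_on_divide:
  assumes "holomorphic_several_on f U" "holomorphic_several_on g U" "\<And>t. t \<in> U \<Longrightarrow> g t \<noteq> 0"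
  shows "holomorphic_several_on (\<lambda>t. f t / g t) U"
  unfolding divide_inverse
  by (intro holomorphic_several_on_mult holomorphic_several_on_inverse assms)

lemma holomorphic_several_on_diff:
  assumes "holomorphic_several_on f U" "holomorphic_several_on g U"
  shows "holomorphic_several_on (\<lambda>t. f t - g t) U"
proof -
  have "open U" using assms(1) unfolding holomorphic_several_on_def by blast
  then have "holomorphic_several_on (\<lambda>t. f t + (-1) * g t) U"
    by (intro holomorphic_several_on_add holomorphic_several_on_mult holomorphic_several_on_const assms)
  then show ?thesis by simp
qed

lemma holomorphic_several_on_sum:
  assumes "open U" "\<And>i. i \<in> A \<Longrightarrow> holomorphic_several_on (f i) U"
  shows "holomorphic_several_on (\<lambda>t. \<Sum>i\<in>A. f i t) U"
  using assms(2)
proof (induction A rule: infinite_finite_induct)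
  case (insert i A)
  then have "holomorphic_several_on (\<lambda>t. f i t + (\<Sum>i\<in>A. f i t)) U"
    by (intro holomorphic_several_on_add) auto
  with insert show ?case by simp
qed (simp_all add: holomorphic_several_on_const assms(1))

lemma holomorphic_several_on_prod:
  assumes "open U" "\<And>i. i \<in> A \<Longrightarrow> holomorphic_several_on (f i) U"
  shows "holomorphic_several_on (\<lambda>t. \<Prod>i\<in>A. f i t) U"
  using assms(2)
proof (induction A rule: infinite_finite_induct)
  case (insert i A)
  then have "holomorphic_several_on (\<lambda>t. f i t * (\<Prod>i\<in>A. f i t)) U"
    by (intro holomorphic_several_on_mult) auto
  with insert show ?case by simp
qed (simp_all add: holomorphic_several_on_const assms(1))

lemma holomorphic_several_on_det:
  assumes "open U" "mat_holomorphic_on M U"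
  shows "holomorphic_several_on (\<lambda>t. det (M t)) U"
  using assms unfolding det_def mat_holomorphic_on_def
  by (simp add: holomorphic_several_on_sum holomorphic_several_on_mult holomorphic_several_on_prod
      holomorphic_several_on_const)

lemma mat_holomorphic_on_mult:
  assumes "open U" "mat_holomorphic_on M U" "mat_holomorphic_on N U"
  shows "mat_holomorphic_on (\<lambda>t. M t ** N t) U"
  using assms unfolding mat_holomorphic_on_def matrix_matrix_mult_def
  by (simp add: holomorphic_several_on_sum holomorphic_several_on_mult)

text \<open>
  Complex linearity turns the derivative along a complex line into multiplication by a complex
  number, so that one-variable theory applies on the line.
\<close>

lemma holomorphic_several_on_complex_line:
  assumes "holomorphic_several_on f U"
  shows "(\<lambda>s. f (a + s *s v)) holomorphic_on {s. a + s *s v \<in> U}"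
  unfolding holomorphic_on_def
proof
  fix s assume "s \<in> {s. a + s *s v \<in> U}"
  then obtain f' where
    f': "(f has_derivative f') (at (a + s *s v))" "\<forall>c v. f' (c *s v) = c * f' v"
    using assms unfolding holomorphic_several_on_def by blast
  have "bounded_linear (\<lambda>s::complex. s *s v)"
    by (intro linear_conv_bounded_linear[THEN iffD1] linearI)
       (simp_all add: vec_eq_iff algebra_simps)
  then have "((\<lambda>s. a + s *s v) has_derivative (\<lambda>s. s *s v)) (at s)"
    by (auto intro!: derivative_eq_intros bounded_linear_imp_has_derivative)
  from has_derivative_compose[OF this f'(1)]
  have "((\<lambda>s. f (a + s *s v)) has_derivative (\<lambda>s. f' (s *s v))) (at s)" by simp
  moreover have "(\<lambda>s. f' (s *s v)) = (*) (f' v)" using f'(2) by (auto simp: mult.commute)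
  ultimately have "((\<lambda>s. f (a + s *s v)) has_field_derivative f' v) (at s)"
    by (simp add: has_field_derivative_def)
  then show "(\<lambda>s. f (a + s *s v)) field_differentiable at s within {s. a + s *s v \<in> U}"
    using field_differentiable_at_within field_differentiable_def by blast
qed

section \<open>Complements of analytic hypersurfaces\<close>

lemma complex_line_ball:
  fixes a v :: "complex ^ 'k"
  shows "open {s::complex. a + s *s v \<in> ball c r}" "connected {s::complex. a + s *s v \<in> ball c r}"
    "continuous_on A (\<lambda>s::complex. a + s *s v)"
proof -
  have lin: "linear (\<lambda>s::complex. s *s v)"
    by (intro linearI) (simp_all add: vec_eq_iff algebra_simps)
  have cont: "continuous_on A (\<lambda>s::complex. a + s *s v)" for A
    by (intro continuous_on_add continuous_on_const linear_continuous_on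
        linear_conv_bounded_linear[THEN iffD1] lin)
  then show "continuous_on A (\<lambda>s::complex. a + s *s v)" .
  have "open ((\<lambda>s. a + s *s v) -` ball c r)" by (intro open_vimage cont open_ball)
  then show "open {s. a + s *s v \<in> ball c r}" by (simp add: vimage_def)
  have "{s. a + s *s v \<in> ball c r} = (\<lambda>s. s *s v) -` ball (c - a) r"
    by (auto simp: dist_norm algebra_simps)
  then have "convex {s. a + s *s v \<in> ball c r}"
    using convex_linear_vimage[OF lin convex_ball] by simp
  then show "connected {s. a + s *s v \<in> ball c r}" by (rule convex_connected)
qed

text \<open>
  The line meets a ball in a connected set, on which the restricted function is not identically
  zero because of its value at \<open>a\<close>; the identity theorem leaves only countably many zeros.
\<close>

lemma countable_zeros_on_complex_line:
  assumes "holomorphic_several_on f (ball c r)" "a \<in> ball c r" "f a \<noteq> 0"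
  shows "countable {s. a + s *s v \<in> ball c r \<and> f (a + s *s v) = 0}"
proof -
  let ?L = "{s. a + s *s v \<in> ball c r}"
  let ?g = "\<lambda>s. f (a + s *s v)"
  have hol: "?g holomorphic_on ?L"
    using assms(1) by (rule holomorphic_several_on_complex_line)
  have "0 \<in> ?L" "?g 0 \<noteq> 0" using assms(2,3) by auto
  have fsigma: "fsigma ?L"
    using open_Union_compact_subsets[OF complex_line_ball(1)[of a v c r]]
    by (metis fsigma_Union_compact image_subset_iff mem_Collect_eq)
  show ?thesis
  proof (cases "?g constant_on ?L")
    case True
    then obtain k where k: "\<And>s. s \<in> ?L \<Longrightarrow> ?g s = k" unfolding constant_on_def by blast
    have "k \<noteq> 0" using k[OF \<open>0 \<in> ?L\<close>] \<open>?g 0 \<noteq> 0\<close> by simp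
    with k have "{s. a + s *s v \<in> ball c r \<and> f (a + s *s v) = 0} = {}" by blast
    then show ?thesis by (metis countable_empty)
  next
    case False
    have "countable {s \<in> ?L. ?g s = 0}"
      by (rule holomorphic_countable_zeros[OF hol complex_line_ball(1,2) _ False]) (rule fsigma)
    then show ?thesis by simp
  qed
qed


text \<open>
  Two nonzeros lie on a complex line, and a connected open subset of the plane stays connected when
  the countably many zeros on that line are removed.
\<close>

lemma connected_ball_diff_zeros:
  assumes hol: "holomorphic_several_on f (ball c r)"
  shows "connected {x \<in> ball c r. f x \<noteq> 0}" (is "connected ?S")
  unfolding connected_iff_connected_component
proof safe
  fix a b assume ab: "a \<in> ball c r" "f a \<noteq> 0" "b \<in> ball c r" "f b \<noteq> 0"
  define v where "v = b - a"
  define L where "L = {s. a + s *s v \<in> ball c r}"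
  define N where "N = {s. a + s *s v \<in> ball c r \<and> f (a + s *s v) = 0}"
  have "open L" "connected L" unfolding L_def by (rule complex_line_ball)+
  moreover have "countable N"
    unfolding N_def using hol ab(1,2) by (rule countable_zeros_on_complex_line)
  ultimately have "connected (L - N)" by (intro connected_open_diff_countable) auto
  then have "connected ((\<lambda>s. a + s *s v) ` (L - N))"
    by (intro connected_continuous_image complex_line_ball(3))
  moreover have "(\<lambda>s. a + s *s v) ` (L - N) \<subseteq> ?S" by (auto simp: L_def N_def)
  moreover have "a \<in> (\<lambda>s. a + s *s v) ` (L - N)"
    using ab by (intro image_eqI[of _ _ 0]) (auto simp: L_def N_def)
  moreover have "b \<in> (\<lambda>s. a + s *s v) ` (L - N)"
    using ab by (intro image_eqI[of _ _ 1]) (auto simp: L_def N_def v_def)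
  ultimately show "connected_component ?S a b" unfolding connected_component_def by blast
qed

text \<open>
  Several-variable identity theorem in the form needed below. Along the line from \<open>a\<close> into \<open>W\<close>
  the zeros are countable, whereas the part of the line inside \<open>W\<close> is uncountable.
\<close>

lemma nonzeros_dense_in_ball:
  assumes hol: "holomorphic_several_on f (ball c r)"
    and "a \<in> ball c r" "f a \<noteq> 0" "open W" "W \<subseteq> ball c r" "W \<noteq> {}"
  shows "\<exists>x\<in>W. f x \<noteq> 0"
proof (rule ccontr)
  assume no: "\<not> (\<exists>x\<in>W. f x \<noteq> 0)"
  obtain w where "w \<in> W" using \<open>W \<noteq> {}\<close> by blast
  define v where "v = w - a"
  let ?V = "(\<lambda>s. a + s *s v) -` W"
  have "open ?V" using \<open>open W\<close> by (intro open_vimage complex_line_ball(3))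
  moreover have "1 \<in> ?V" using \<open>w \<in> W\<close> by (simp add: v_def)
  ultimately obtain e where "e > 0" "ball 1 e \<subseteq> ?V" by (meson openE)
  then have "uncountable ?V" using uncountable_ball[of e "1::complex"] countable_subset by blast
  moreover have "?V \<subseteq> {s. a + s *s v \<in> ball c r \<and> f (a + s *s v) = 0}"
    using no \<open>W \<subseteq> ball c r\<close> by blast
  ultimately show False
    using countable_zeros_on_complex_line[OF hol assms(2,3)] countable_subset by blast
qed

text \<open>
  The set \<open>Z\<close> is described locally only, so it might contain an open piece of \<open>D\<close>. Connectedness
  of \<open>D\<close> excludes this once a single point of \<open>D\<close> is outside \<open>Z\<close>: the interior of \<open>Z\<close> and the points
  near which \<open>Z\<close> has empty interior form an open partition of \<open>D\<close>. Given density, local connectedness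
  of the complement extends to the whole of \<open>D\<close>.
\<close>

lemma is_domain_diff_analytic_hypersurface:
  fixes D Z :: "(complex ^ 'k) set"
  assumes "connected D" and "D - Z \<noteq> {}"
    and loc: "\<And>t. t \<in> D \<Longrightarrow> \<exists>r>0. \<exists>f. ball t r \<subseteq> D \<and> holomorphic_several_on f (ball t r) \<and>
                (\<forall>x \<in> ball t r. x \<in> Z \<longleftrightarrow> f x = 0)"
  shows "is_domain (D - Z)"
proof -
  define nowhere_dense where "nowhere_dense = (\<lambda>V. \<forall>W. open W \<and> W \<subseteq> V \<and> W \<noteq> {} \<longrightarrow> W - Z \<noteq> {})"
  have diff: "ball t r - Z = {x \<in> ball t r. f x \<noteq> 0}"
    if "\<forall>x \<in> ball t r. x \<in> Z \<longleftrightarrow> f x = 0" for t r and f :: "complex ^ 'k \<Rightarrow> complex"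
    using that by blast
  have open_diff: "open (D - Z)"
  proof (rule Topological_Spaces.openI)
    fix t assume "t \<in> D - Z"
    then have "t \<in> D" "t \<notin> Z" by auto
    then obtain r f where rf: "r > 0" "ball t r \<subseteq> D" "holomorphic_several_on f (ball t r)"
      "\<forall>x \<in> ball t r. x \<in> Z \<longleftrightarrow> f x = 0"
      using loc[OF \<open>t \<in> D\<close>] by blast
    have "continuous_on (ball t r) f"
      using rf(3) by (rule holomorphic_several_on_imp_continuous_on)
    then have "open (ball t r \<inter> f -` (- {0}))"
      by (rule continuous_open_preimage) auto
    moreover have "ball t r \<inter> f -` (- {0}) = ball t r - Z" using rf(4) by auto
    ultimately have "open (ball t r - Z)" by simp
    then show "\<exists>T. open T \<and> t \<in> T \<and> T \<subseteq> D - Z"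
      using rf(1,2) \<open>t \<notin> Z\<close> by (intro exI[of _ "ball t r - Z"]) auto
  qed
  \<comment> \<open>Either \<open>Z\<close> contains a ball around \<open>t\<close> or it is nowhere dense near \<open>t\<close>; both alternatives are
     open conditions, and the first one fails somewhere.\<close>
  define E where "E = interior Z"
  define C where "C = \<Union>{V. open V \<and> nowhere_dense V}"
  have "D \<subseteq> E \<union> C"
  proof
    fix t assume "t \<in> D"
    then obtain r f where rf: "r > 0" "ball t r \<subseteq> D" "holomorphic_several_on f (ball t r)"
      "\<forall>x \<in> ball t r. x \<in> Z \<longleftrightarrow> f x = 0"
      using loc[OF \<open>t \<in> D\<close>] by blast
    show "t \<in> E \<union> C"
    proof (cases "\<exists>a \<in> ball t r. f a \<noteq> 0")
      case True
      then have "nowhere_dense (ball t r)"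
        unfolding nowhere_dense_def using nonzeros_dense_in_ball[OF rf(3)] rf(4) by blast
      then show ?thesis using \<open>r > 0\<close> unfolding C_def by (metis (mono_tags, lifting) CollectI UnI2 UnionI centre_in_ball open_ball)
    next
      case False
      then have "ball t r \<subseteq> Z" using rf(4) by blast
      then show ?thesis using \<open>r > 0\<close> unfolding E_def by (meson UnI1 centre_in_ball interiorI open_ball)
    qed
  qed
  moreover have "E \<inter> C = {}"
  proof (rule ccontr)
    assume "E \<inter> C \<noteq> {}"
    then obtain V where V: "open V" "nowhere_dense V" "E \<inter> V \<noteq> {}" unfolding C_def by blast
    then have "E \<inter> V - Z \<noteq> {}" unfolding nowhere_dense_def E_def by (metis inf_le2 open_Int open_interior)
    then show False using interior_subset unfolding E_def by blast
  qed
  moreover have "open E" "open C" unfolding E_def C_def by auto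
  moreover have "\<not> D \<subseteq> E" using \<open>D - Z \<noteq> {}\<close> interior_subset unfolding E_def by blast
  ultimately have "D \<inter> E = {}"
    using connectedD[OF \<open>connected D\<close>, of E C] by blast
  then have "D \<subseteq> C" using \<open>D \<subseteq> E \<union> C\<close> by blast
  have dense: "W - Z \<noteq> {}" if W: "open W" "W \<subseteq> D" "W \<noteq> {}" for W
  proof -
    obtain V where V: "open V" "nowhere_dense V" "W \<inter> V \<noteq> {}"
      using W \<open>D \<subseteq> C\<close> unfolding C_def by blast
    then have "W \<inter> V - Z \<noteq> {}" using W(1) unfolding nowhere_dense_def by (meson inf_le2 open_Int)
    then show ?thesis by blast
  qed
  have "connected (D - Z)"
  proof (rule connectedI)
    fix A B
    assume AB: "open A" "open B" "A \<inter> (D - Z) \<noteq> {}" "B \<inter> (D - Z) \<noteq> {}"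
      "A \<inter> B \<inter> (D - Z) = {}" "D - Z \<subseteq> A \<union> B"
    \<comment> \<open>A separation of \<open>D - Z\<close> extends across \<open>Z\<close> to a separation of \<open>D\<close>.\<close>
    define ext where "ext = (\<lambda>A. \<Union>{V. open V \<and> V \<subseteq> D \<and> V - Z \<subseteq> A})"
    have "open (ext X)" for X unfolding ext_def by auto
    moreover have "D \<inter> ext X \<noteq> {}" if "open X" "X \<inter> (D - Z) \<noteq> {}" for X
    proof -
      have "open (X \<inter> (D - Z))" using \<open>open X\<close> open_diff by (rule open_Int)
      then have "X \<inter> (D - Z) \<subseteq> ext X" unfolding ext_def by blast
      then show ?thesis using that by blast
    qed
    moreover have "D \<subseteq> ext A \<union> ext B"
    proof
      fix t assume "t \<in> D"
      then obtain r f where rf: "r > 0" "ball t r \<subseteq> D" "holomorphic_several_on f (ball t r)"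
        "\<forall>x \<in> ball t r. x \<in> Z \<longleftrightarrow> f x = 0"
        using loc[OF \<open>t \<in> D\<close>] by blast
      have "connected (ball t r - Z)"
        unfolding diff[OF rf(4)] using rf(3) by (rule connected_ball_diff_zeros)
      moreover have "A \<inter> B \<inter> (ball t r - Z) = {}" "ball t r - Z \<subseteq> A \<union> B"
        using AB(5,6) rf(2) by blast+
      ultimately have "A \<inter> (ball t r - Z) = {} \<or> B \<inter> (ball t r - Z) = {}"
        using AB(1,2) connectedD by blast
      then have "ball t r - Z \<subseteq> A \<or> ball t r - Z \<subseteq> B"
        using \<open>ball t r - Z \<subseteq> A \<union> B\<close> by blast
      then have "ball t r \<subseteq> ext A \<or> ball t r \<subseteq> ext B" using rf(2) unfolding ext_def by blast
      moreover have "t \<in> ball t r" using \<open>r > 0\<close> by simp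
      ultimately show "t \<in> ext A \<union> ext B" by blast
    qed
    moreover have "ext A \<inter> ext B \<inter> D = {}"
    proof (rule ccontr)
      assume "ext A \<inter> ext B \<inter> D \<noteq> {}"
      then obtain V W where "open V" "V \<subseteq> D" "V - Z \<subseteq> A" "open W" "W \<subseteq> D" "W - Z \<subseteq> B"
        "V \<inter> W \<noteq> {}"
        unfolding ext_def by blast
      then have "V \<inter> W - Z \<noteq> {}" by (intro dense) auto
      then show False using AB(5) \<open>V \<subseteq> D\<close> \<open>V - Z \<subseteq> A\<close> \<open>W - Z \<subseteq> B\<close> by blast
    qed
    ultimately show False
      using \<open>connected D\<close> AB(1-4) connectedD[of D "ext A" "ext B"] by blast
  qed
  with open_diff \<open>D - Z \<noteq> {}\<close> show ?thesis unfolding is_domain_def by blast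
qed

section \<open>Partial fractions with simple poles\<close>

text \<open>
  Let the \<open>p k\<close> be distinct. At \<open>z = p k\<close> the convention \<open>x / 0 = 0\<close> drops the \<open>k\<close>-th term. If \<open>a k = 0\<close> this is the
  analytic value, as a fraction in lowest terms demands; otherwise the point is a genuine pole.
\<close>

definition partial_fraction :: "complex \<Rightarrow> ('n::finite \<Rightarrow> complex) \<Rightarrow> ('n \<Rightarrow> complex) \<Rightarrow> complex \<Rightarrow> complex" where
  "partial_fraction c a p z = c + (\<Sum>k\<in>UNIV. a k / (z - p k))"

lemma partial_fraction_analytic:
  assumes "\<And>k. p k = z \<Longrightarrow> a k = 0"
  shows "partial_fraction c a p analytic_on {z}"
proof -
  have "(\<lambda>w. a k / (w - p k)) analytic_on {z}" for k
  proof (cases "p k = z")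
    case True
    then have "(\<lambda>w. a k / (w - p k)) = (\<lambda>_. 0)" using assms by auto
    then show ?thesis by simp
  next
    case False
    then show ?thesis by (intro analytic_intros) auto
  qed
  then show ?thesis
    unfolding partial_fraction_def[abs_def] by (intro analytic_on_add analytic_on_const analytic_on_sum)
qed

lemma partial_fraction_split:
  "partial_fraction c a p z = a k / (z - p k) + partial_fraction c (a(k := 0)) p z"
proof -
  have "(\<Sum>l\<in>UNIV. a l / (z - p l)) = a k / (z - p k) + (\<Sum>l\<in>UNIV - {k}. a l / (z - p l))"
    by (simp add: sum.remove)
  moreover have "(\<Sum>l\<in>UNIV. (a(k := 0)) l / (z - p l)) = (\<Sum>l\<in>UNIV - {k}. a l / (z - p l))"
    by (subst sum.remove[of _ k]) auto
  ultimately show ?thesis by (simp add: partial_fraction_def)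
qed

lemma partial_fraction_times_linear:
  assumes "inj p"
  shows "(\<lambda>z. a k + (z - p k) * partial_fraction c (a(k := 0)) p z) analytic_on {p k}"
    and "\<forall>\<^sub>F z in at (p k). (z - p k) * partial_fraction c a p z =
           a k + (z - p k) * partial_fraction c (a(k := 0)) p z"
proof -
  have "partial_fraction c (a(k := 0)) p analytic_on {p k}"
    using \<open>inj p\<close> by (intro partial_fraction_analytic) (auto dest: injD)
  then show "(\<lambda>z. a k + (z - p k) * partial_fraction c (a(k := 0)) p z) analytic_on {p k}"
    by (intro analytic_intros)
  have "(z - p k) * partial_fraction c a p z = a k + (z - p k) * partial_fraction c (a(k := 0)) p z"
    if "z \<noteq> p k" for z
    using that partial_fraction_split[of c a p z k] by (simp add: field_simps)
  then show "\<forall>\<^sub>F z in at (p k). (z - p k) * partial_fraction c a p z =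
           a k + (z - p k) * partial_fraction c (a(k := 0)) p z"
    by (auto simp: eventually_at_filter)
qed

text \<open>
  Only the behaviour near \<open>t\<close> matters, so the lemma applies to functions with an arbitrary value at
  the pole.
\<close>

lemma residue_eq_limit:
  assumes "h analytic_on {t}" "\<forall>\<^sub>F z in at t. (z - t) * f z = h z"
  shows "residue f t = h t"
proof -
  obtain A where A: "open A" "t \<in> A" "h holomorphic_on A"
    using assms(1) analytic_at by blast
  have "\<forall>\<^sub>F z in at t. f z = h z / (z - t)"
    using assms(2) by (auto simp: eventually_at_filter field_simps elim!: eventually_mono)
  then have "residue f t = residue (\<lambda>z. h z / (z - t)) t" by (intro residue_cong) auto
  also have "\<dots> = h t" using A by (rule residue_simple)
  finally show ?thesis .
qed

lemma residue_partial_fraction: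
  assumes "inj p"
  shows "residue (partial_fraction c a p) (p k) = a k"
  using residue_eq_limit[OF partial_fraction_times_linear(1)[OF assms, of a k c]
      partial_fraction_times_linear(2)[OF assms, of k c a]] by simp

lemma tendsto_divide_linear_at_infinity:
  "((\<lambda>z::complex. a / (z - b)) \<longlongrightarrow> 0) at_infinity"
proof -
  have "filterlim (\<lambda>z::complex. z + (- b)) at_infinity at_infinity"
    by (rule tendsto_add_filterlim_at_infinity'[OF filterlim_ident tendsto_const])
  then show ?thesis by (intro tendsto_divide_0[OF tendsto_const]) simp
qed

lemma partial_fraction_tendsto:
  "(partial_fraction c a p \<longlongrightarrow> c) at_infinity"
proof -
  have "((\<lambda>z. c + (\<Sum>k\<in>UNIV. a k / (z - p k))) \<longlongrightarrow> c + (\<Sum>k\<in>(UNIV::'a set). 0)) at_infinity"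
    by (intro tendsto_add tendsto_const tendsto_sum tendsto_divide_linear_at_infinity)
  then show ?thesis by (simp add: partial_fraction_def[abs_def])
qed

lemma partial_fraction_deriv:
  assumes "z \<notin> range p"
  shows "(partial_fraction c a p has_field_derivative - (\<Sum>k\<in>UNIV. a k / (z - p k)\<^sup>2)) (at z)"
proof -
  have "((\<lambda>z. a k / (z - p k)) has_field_derivative - (a k / (z - p k)\<^sup>2)) (at z)" for k
  proof -
    have "z - p k \<noteq> 0" using assms by auto
    then show ?thesis
      by (auto intro!: derivative_eq_intros simp: power2_eq_square)
  qed
  then have "((\<lambda>z. c + (\<Sum>k\<in>UNIV. a k / (z - p k))) has_field_derivative
      0 + (\<Sum>k\<in>UNIV. - (a k / (z - p k)\<^sup>2))) (at z)"
    by (intro DERIV_add DERIV_const DERIV_sum)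
  then show ?thesis by (simp add: partial_fraction_def[abs_def] sum_negf)
qed

lemma partial_fraction_at_infinity:
  "\<exists>h. h analytic_on {0} \<and> (\<forall>\<^sub>F w in at 0. partial_fraction c a p (1 / w) = h w)"
proof (intro exI conjI)
  show "(\<lambda>w. c + (\<Sum>k\<in>UNIV. a k * w / (1 - p k * w))) analytic_on {0}"
    by (intro analytic_intros) auto
  have "a k / (1 / w - p k) = a k * w / (1 - p k * w)" if "w \<noteq> 0" for w k
  proof -
    have "1 / w - p k = (1 - p k * w) / w" using that by (simp add: field_simps)
    then show ?thesis by simp
  qed
  then show "\<forall>\<^sub>F w in at 0. partial_fraction c a p (1 / w) =
      c + (\<Sum>k\<in>UNIV. a k * w / (1 - p k * w))"
    by (auto simp: eventually_at_filter partial_fraction_def)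
qed

lemma coprime_if_no_common_root:
  fixes f g :: "complex poly"
  assumes "g \<noteq> 0" "\<And>z. poly g z = 0 \<Longrightarrow> poly f z \<noteq> 0"
  shows "coprime f g"
proof (rule coprimeI)
  fix d assume d: "d dvd f" "d dvd g"
  then have "d \<noteq> 0" using \<open>g \<noteq> 0\<close> by auto
  have "degree d = 0"
  proof (rule ccontr)
    assume "degree d \<noteq> 0"
    then obtain z where "poly d z = 0"
      using alg_closed_imp_poly_has_root[of d] by blast
    then have "poly f z = 0" "poly g z = 0" using d by (auto elim!: dvdE)
    then show False using assms(2) by blast
  qed
  with \<open>d \<noteq> 0\<close> show "is_unit d" by (simp add: is_unit_iff_degree)
qed

text \<open>
  Only the indices with \<open>a k \<noteq> 0\<close> may enter the denominator. With all of them, numerator and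
  denominator would share the root \<open>p k\<close> whenever \<open>a k = 0\<close> and the fraction would not be in lowest
  terms.
\<close>

lemma rational_fun_partial_fraction:
  assumes "inj p"
  shows "rational_fun (partial_fraction c a p)"
proof -
  define K where "K = {k. a k \<noteq> 0}"
  define q where "q = (\<Prod>k\<in>K. [:- p k, 1:])"
  define qk where "qk = (\<lambda>k. \<Prod>l\<in>K - {k}. [:- p l, 1:])"
  define f where "f = smult c q + (\<Sum>k\<in>K. smult (a k) (qk k))"
  have poly_q: "poly q z = (\<Prod>k\<in>K. z - p k)" for z by (simp add: q_def poly_prod)
  have poly_qk: "poly (qk k) z = (\<Prod>l\<in>K - {k}. z - p l)" for k z by (simp add: qk_def poly_prod)
  have "q \<noteq> 0" by (simp add: q_def)
  moreover have "coprime f q"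
  proof (rule coprime_if_no_common_root[OF \<open>q \<noteq> 0\<close>])
    fix z assume "poly q z = 0"
    then obtain k where k: "k \<in> K" "z = p k" by (auto simp: poly_q)
    have "poly (qk l) (p k) = 0" if "l \<in> K - {k}" for l
      using k(1) that by (auto simp: poly_qk)
    then have "(\<Sum>l\<in>K. poly (smult (a l) (qk l)) (p k)) = a k * poly (qk k) (p k)"
      using k(1) by (subst sum.remove[of _ k]) auto
    moreover have "poly (qk k) (p k) \<noteq> 0"
      using \<open>inj p\<close> by (auto simp: poly_qk dest: injD)
    ultimately show "poly f z \<noteq> 0"
      using k \<open>poly q z = 0\<close> by (simp add: f_def poly_sum K_def)
  qed
  moreover have "partial_fraction c a p z = poly f z / poly q z" if "poly q z \<noteq> 0" for z
  proof -
    have "poly q z = (z - p k) * poly (qk k) z" if "k \<in> K" for k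
      using that unfolding poly_q poly_qk by (subst prod.remove[of _ k]) auto
    then have summand: "a k * poly (qk k) z / poly q z = a k / (z - p k)" if "k \<in> K" for k
      using that \<open>poly q z \<noteq> 0\<close> by (simp add: divide_simps)
    have "poly f z / poly q z = c + (\<Sum>k\<in>K. a k * poly (qk k) z / poly q z)"
      using that by (simp add: f_def poly_sum add_divide_distrib sum_divide_distrib)
    also have "\<dots> = c + (\<Sum>k\<in>K. a k / (z - p k))" using summand by simp
    also have "(\<Sum>k\<in>K. a k / (z - p k)) = (\<Sum>k\<in>UNIV. a k / (z - p k))"
      by (rule sum.mono_neutral_left) (auto simp: K_def)
    finally show ?thesis by (simp add: partial_fraction_def)
  qed
  ultimately show ?thesis unfolding rational_fun_def by blast
qed

text \<open>
  The germ at \<open>t\<close> on a punctured neighbourhood already forces the right value at \<open>t\<close>: if the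
  denominator vanished there, the numerator would vanish too, against coprimality.
\<close>

lemma rational_fun_analytic:
  assumes "rational_fun f" "h analytic_on {t}" "\<forall>\<^sub>F z in at t. f z = h z"
  shows "f analytic_on {t}"
proof -
  obtain p q where pq: "q \<noteq> 0" "coprime p q" "\<And>z. poly q z \<noteq> 0 \<Longrightarrow> f z = poly p z / poly q z"
    using assms(1) unfolding rational_fun_def by blast
  have "poly q t \<noteq> 0"
  proof
    assume "poly q t = 0"
    then have "poly p t \<noteq> 0"
      using \<open>coprime p q\<close> by (metis coprime_poly_0)
    have "\<forall>\<^sub>F z in at t. z \<notin> {z. poly q z = 0}"
      using poly_roots_finite[OF \<open>q \<noteq> 0\<close>]
      by (metis islimpt_finite islimpt_iff_eventually)
    with assms(3) have "\<forall>\<^sub>F z in at t. h z * poly q z = poly p z"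
      by eventually_elim (auto simp: pq(3) field_simps)
    moreover have "((\<lambda>z. h z * poly q z) \<longlongrightarrow> h t * poly q t) (at t)"
      using analytic_at_imp_isCont[OF assms(2)] by (intro tendsto_intros) (simp_all add: isContD)
    ultimately have "(poly p \<longlongrightarrow> h t * poly q t) (at t)"
      using tendsto_cong[of "\<lambda>z. h z * poly q z" "poly p" "at t"] by blast
    moreover have "(poly p \<longlongrightarrow> poly p t) (at t)"
      by (simp add: isContD)
    ultimately show False
      using LIM_unique[of "poly p" "h t * poly q t" t "poly p t"] \<open>poly p t \<noteq> 0\<close> \<open>poly q t = 0\<close>
      by simp
  qed
  have poly_analytic: "poly r analytic_on {t}" for r
    unfolding analytic_on_holomorphic holomorphic_on_def field_differentiable_def
    by (intro exI[of _ UNIV]) (auto intro: has_field_derivative_at_within poly_DERIV)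
  have "(\<lambda>z. poly p z / poly q z) analytic_on {t}"
    using \<open>poly q t \<noteq> 0\<close> by (intro analytic_intros poly_analytic) auto
  moreover have "\<forall>\<^sub>F z in nhds t. f z = poly p z / poly q z"
  proof -
    have "open {z. poly q z \<noteq> 0}" by (intro open_Collect_neq continuous_intros)
    then show ?thesis
      using \<open>poly q t \<noteq> 0\<close> pq(3) by (auto simp: eventually_nhds)
  qed
  ultimately show ?thesis using analytic_at_cong[of f "\<lambda>z. poly p z / poly q z" t t] by simp
qed

lemma remove_sings_analytic:
  assumes "h analytic_on {t}" "\<forall>\<^sub>F z in at t. f z = h z"
  shows "remove_sings f analytic_on {t}"
proof -
  obtain A where A: "open A" "t \<in> A" "h holomorphic_on A" using assms(1) analytic_at by blast
  have "isolated_singularity_at h t"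
    using assms(1) by (rule isolated_singularity_at_analytic)
  then have "isolated_singularity_at f t"
    using assms(2) isolated_singularity_at_cong by blast
  moreover have "f \<midarrow>t\<rightarrow> h t"
    using assms(2) analytic_at_imp_isCont[OF assms(1)] isContD tendsto_cong by blast
  ultimately show ?thesis by (rule remove_sings_analytic_at)
qed

text \<open>
  After subtracting the simple fractions only removable singularities are left. The resulting entire
  function has the limit \<open>c\<close> at infinity and is constant by Liouville's theorem.
\<close>

lemma rational_fun_eq_partial_fraction:
  assumes "rational_fun f" "inj p" "(f \<longlongrightarrow> c) at_infinity"
    and hol: "\<And>z. z \<notin> range p \<Longrightarrow> \<exists>h. h analytic_on {z} \<and> (\<forall>\<^sub>F w in at z. f w = h w)"
    and pole: "\<And>k. \<exists>h. h analytic_on {p k} \<and> (\<forall>\<^sub>F w in at (p k). (w - p k) * f w = h w)"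
    and "z \<notin> range p"
  shows "f z = partial_fraction c (\<lambda>k. residue f (p k)) p z"
proof -
  define a where "a = (\<lambda>k. residue f (p k))"
  define g where "g = (\<lambda>z. f z - partial_fraction 0 a p z)"
  have g_analytic: "g analytic_on {z}" if "z \<notin> range p" for z
    unfolding g_def using hol[OF that] rational_fun_analytic[OF assms(1)] that
    by (intro analytic_intros partial_fraction_analytic) auto
  have "remove_sings g analytic_on {z}" for z
  proof (cases "z \<in> range p")
    case False
    then show ?thesis by (intro remove_sings_analytic_on g_analytic)
  next
    case True
    then obtain k where k: "z = p k" by blast
    obtain h where h: "h analytic_on {p k}" "\<forall>\<^sub>F w in at (p k). (w - p k) * f w = h w"
      using pole by blast
    have "a k = h (p k)" unfolding a_def using h by (rule residue_eq_limit)
    \<comment> \<open>The difference quotient of \<open>h\<close> is what remains of \<open>f\<close> when its principal part is removed.\<close>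
    define h' where "h' = (\<lambda>w. if w = p k then deriv h (p k) else (h w - h (p k)) / (w - p k))"
    obtain A where A: "open A" "p k \<in> A" "h holomorphic_on A" using h(1) analytic_at by blast
    then have "h' holomorphic_on A"
      unfolding h'_def by (intro pole_lemma_open)
    then have "h' analytic_on {p k}" using A analytic_at by blast
    moreover have "partial_fraction 0 (a(k := 0)) p analytic_on {p k}"
      using \<open>inj p\<close> by (intro partial_fraction_analytic) (auto dest: injD)
    ultimately have "(\<lambda>w. h' w - partial_fraction 0 (a(k := 0)) p w) analytic_on {p k}"
      by (intro analytic_intros)
    moreover have "\<forall>\<^sub>F w in at (p k). g w = h' w - partial_fraction 0 (a(k := 0)) p w"
    proof -
      have "\<forall>\<^sub>F w in at (p k). w \<noteq> p k" by (simp add: eventually_at_filter)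
      with h(2) show ?thesis
      proof eventually_elim
        case (elim w)
        then have "f w = h w / (w - p k)" by (simp add: field_simps)
        then show ?case
          using elim partial_fraction_split[of 0 a p w k] \<open>a k = h (p k)\<close>
          by (simp add: g_def h'_def diff_divide_distrib)
      qed
    qed
    ultimately show ?thesis unfolding k by (rule remove_sings_analytic)
  qed
  then have "remove_sings g holomorphic_on UNIV"
    using analytic_on_analytic_at analytic_imp_holomorphic by blast
  moreover have "(remove_sings g \<longlongrightarrow> c) at_infinity"
  proof -
    have "(g \<longlongrightarrow> c - 0) at_infinity"
      unfolding g_def by (intro tendsto_diff assms(3) partial_fraction_tendsto)
    moreover have "\<forall>\<^sub>F w in at_infinity. remove_sings g w = g w"
    proof -
      have "bounded (range p)" by (simp add: finite_imp_bounded)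
      then obtain B where B: "\<And>k. norm (p k) \<le> B" unfolding bounded_iff by blast
      then have "remove_sings g w = g w" if "norm w \<ge> B + 1" for w
      proof (intro remove_sings_at_analytic g_analytic notI)
        assume "w \<in> range p"
        then obtain k where "w = p k" by blast
        then show False using B[of k] that by simp
      qed
      then show ?thesis unfolding eventually_at_infinity by blast
    qed
    ultimately show ?thesis by (simp add: tendsto_cong)
  qed
  ultimately have "remove_sings g z = c" by (rule Liouville_weak)
  then have "g z = c" using g_analytic[OF assms(6)] by simp
  then show ?thesis by (simp add: g_def partial_fraction_def a_def algebra_simps)
qed

section \<open>Realizations of rational matrix functions\<close>

lemma matrix_diff_ldistrib: "A ** (B - C) = A ** B - A ** (C :: complex ^ 'n ^ 'm)"
  by (simp add: matrix_matrix_mult_def vec_eq_iff sum_subtractf algebra_simps)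

lemma matrix_diff_rdistrib: "(A - B) ** C = A ** C - (B :: complex ^ 'n ^ 'm) ** C"
  by (simp add: matrix_matrix_mult_def vec_eq_iff sum_subtractf algebra_simps)

lemma matrix_add_rdistrib: "(A + B) ** C = A ** C + (B :: complex ^ 'n ^ 'm) ** C"
  by (simp add: matrix_matrix_mult_def vec_eq_iff sum.distrib algebra_simps)

lemma matrix_minus_left: "(- A) ** C = - ((A :: complex ^ 'n ^ 'm) ** C)"
  by (simp add: matrix_matrix_mult_def vec_eq_iff sum_negf)

lemma matrix_minus_right: "A ** (- C) = - (A ** (C :: complex ^ 'n ^ 'm))"
  by (simp add: matrix_matrix_mult_def vec_eq_iff sum_negf)

lemma matrix_mult_nth: "(A ** B) $ i $ j = (\<Sum>k\<in>UNIV. A $ i $ k * B $ k $ j)"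
  by (simp add: matrix_matrix_mult_def)

lemma matrix_inv_unique:
  fixes A B :: "complex ^ 'n ^ 'n"
  assumes "A ** B = mat 1"
  shows "matrix_inv A = B"
proof -
  have "A ** B = mat 1 \<and> B ** A = mat 1"
    using assms matrix_left_right_inverse[of A B] by simp
  then have "A ** matrix_inv A = mat 1 \<and> matrix_inv A ** A = mat 1"
    unfolding matrix_inv_def by (rule someI)
  then have "matrix_inv A = (matrix_inv A ** A) ** B"
    by (metis assms matrix_mul_assoc matrix_mul_rid)
  then show ?thesis
    using \<open>A ** matrix_inv A = mat 1 \<and> matrix_inv A ** A = mat 1\<close> by simp
qed

lemma matrix_inv_inverse:
  fixes A :: "complex ^ 'n ^ 'n"
  assumes "invertible A"
  shows "A ** matrix_inv A = mat 1" "matrix_inv A ** A = mat 1"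
proof -
  obtain B where "A ** B = mat 1" "B ** A = mat 1" using assms unfolding invertible_def by blast
  then show "A ** matrix_inv A = mat 1" "matrix_inv A ** A = mat 1"
    by (simp_all add: matrix_inv_unique)
qed

lemma diag_mat_mult_left_nth: "(diag_mat d ** A) $ i $ j = d i * A $ i $ j"
proof -
  have "(\<Sum>k\<in>UNIV. (if i = k then d i else 0) * A $ k $ j) =
      (\<Sum>k\<in>UNIV. if i = k then d i * A $ k $ j else 0)"
    by (intro sum.cong) auto
  then show ?thesis by (simp add: diag_mat_def matrix_matrix_mult_def)
qed

lemma diag_mat_mult_right_nth: "(B ** diag_mat d) $ i $ j = B $ i $ j * d j"
proof -
  have "(\<Sum>k\<in>UNIV. B $ i $ k * (if k = j then d k else 0)) =
      (\<Sum>k\<in>UNIV. if k = j then B $ i $ k * d k else 0)"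
    by (intro sum.cong) auto
  then show ?thesis by (simp add: diag_mat_def matrix_matrix_mult_def)
qed

lemmas diag_mat_mult_nth = diag_mat_mult_left_nth diag_mat_mult_right_nth

lemma diag_mat_mult: "diag_mat a ** diag_mat b = diag_mat (\<lambda>k. a k * b k)"
  by (simp add: vec_eq_iff diag_mat_mult_left_nth) (simp add: diag_mat_def)

lemma mat_minus_diag_mat: "mat z - diag_mat d = diag_mat (\<lambda>k. z - d k)"
  by (simp add: vec_eq_iff diag_mat_def mat_def)

lemma matrix_inv_mat_minus_diag:
  assumes "z \<notin> range d"
  shows "matrix_inv (mat z - diag_mat d) = diag_mat (\<lambda>k. 1 / (z - d k))"
proof (rule matrix_inv_unique)
  have "z - d k \<noteq> 0" for k using assms by auto
  then show "(mat z - diag_mat d) ** diag_mat (\<lambda>k. 1 / (z - d k)) = mat 1"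
    by (simp add: mat_minus_diag_mat diag_mat_mult) (simp add: diag_mat_def mat_def)
qed

lemma col_times_row_eq_0_iff: "col_times_row f g = 0 \<longleftrightarrow> f = 0 \<or> g = 0"
  by (auto simp: col_times_row_def vec_eq_iff)

text \<open>
  All rows are multiples of \<open>g\<close>, and \<open>g\<close> itself is a multiple of one of them.
\<close>

lemma rank_col_times_row:
  assumes "f \<noteq> 0" "g \<noteq> 0"
  shows "rank (col_times_row f g) = 1"
proof -
  obtain i where i: "f $ i \<noteq> 0" using \<open>f \<noteq> 0\<close> by (auto simp: vec_eq_iff)
  have row: "row j (col_times_row f g) = f $ j *s g" for j
    by (simp add: vec_eq_iff row_def col_times_row_def)
  have "g = inverse (f $ i) *s row i (col_times_row f g)"
    using i by (simp add: row vec_eq_iff)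
  moreover have "row i (col_times_row f g) \<in> rows (col_times_row f g)"
    by (auto simp: rows_def)
  ultimately have "g \<in> vec.span (rows (col_times_row f g))"
    by (metis vec.span_base vec.span_scale)
  moreover have "rows (col_times_row f g) \<subseteq> vec.span {g}"
    by (auto simp: rows_def row intro: vec.span_scale vec.span_base)
  ultimately have "vec.span (rows (col_times_row f g)) = vec.span {g}"
    by (intro vec.span_eq[THEN iffD2]) auto
  then have "vec.dim (rows (col_times_row f g)) = vec.dim {g}"
    by (metis vec.dim_span)
  also have "\<dots> = 1"
    using vec.dim_eq_card_independent[of "{g}"] \<open>g \<noteq> 0\<close> by simp
  finally show ?thesis by (simp add: row_rank_def_gen)
qed

lemma rank_zero: "rank (0 :: complex ^ 'n ^ 'm) = 0"
proof -
  have "rows (0 :: complex ^ 'n ^ 'm) = {0}" by (auto simp: rows_def row_def vec_eq_iff)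
  then show ?thesis by (simp add: row_rank_def_gen)
qed

text \<open>
  The resolvent \<open>(z I - diag p)\<^sup>-\<^sup>1\<close> is written entrywise, which keeps the function meaningful at
  \<open>z = p k\<close> in all entries without a pole there.
\<close>

definition realization ::
    "('n::finite \<Rightarrow> complex) \<Rightarrow> complex ^ 'n ^ 'm \<Rightarrow> complex ^ 'm ^ 'n \<Rightarrow> complex \<Rightarrow> complex ^ 'm ^ 'm" where
  "realization p C B z = mat 1 + C ** diag_mat (\<lambda>k. 1 / (z - p k)) ** B"

lemma realization_nth:
  "realization p C B z $ i $ j =
     partial_fraction ((mat 1 :: complex ^ 'm ^ 'm) $ i $ j) (\<lambda>k. C $ i $ k * B $ k $ j) p z"
  for C :: "complex ^ 'n::finite ^ 'm"
proof -
  have "(C ** diag_mat (\<lambda>k. 1 / (z - p k)) ** B) $ i $ j =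
      (\<Sum>k\<in>UNIV. C $ i $ k * B $ k $ j / (z - p k))"
    by (subst matrix_mult_nth) (simp add: diag_mat_mult_nth)
  then show ?thesis by (simp add: realization_def partial_fraction_def)
qed

lemma mat_rational_realization: "inj p \<Longrightarrow> mat_rational (realization p C B)"
  unfolding mat_rational_def realization_nth by (simp add: rational_fun_partial_fraction)

lemma realization_analytic:
  "z \<notin> range p \<Longrightarrow> (\<lambda>w. realization p C B w $ i $ j) analytic_on {z}"
  unfolding realization_nth by (intro partial_fraction_analytic) auto

lemma mat_holomorphic_at_realization:
  "z \<notin> range p \<Longrightarrow> mat_holomorphic_at (realization p C B) z"
  unfolding mat_holomorphic_at_def
proof (intro allI)
  fix i j assume "z \<notin> range p"
  then show "\<exists>h. h analytic_on {z} \<and> (\<forall>\<^sub>F w in at z. realization p C B w $ i $ j = h w)"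
    by (intro exI[of _ "\<lambda>w. realization p C B w $ i $ j"]) (simp add: realization_analytic)
qed

lemma mat_holomorphic_at_cong:
  assumes "\<forall>\<^sub>F z in at t. R z = R' z"
  shows "mat_holomorphic_at R t \<longleftrightarrow> mat_holomorphic_at R' t"
proof -
  have "(\<forall>\<^sub>F z in at t. R z $ i $ j = h z) \<longleftrightarrow> (\<forall>\<^sub>F z in at t. R' z $ i $ j = h z)" for i j h
    by (rule eventually_cong[OF assms]) simp
  then show ?thesis by (simp add: mat_holomorphic_at_def)
qed

lemma mat_simple_pole_cong:
  assumes "\<forall>\<^sub>F z in at t. R z = R' z"
  shows "mat_simple_pole R t \<longleftrightarrow> mat_simple_pole R' t"
proof -
  have "\<forall>\<^sub>F z in at t. (\<chi> i j. (z - t) * R z $ i $ j) = (\<chi> i j. (z - t) * R' z $ i $ j)"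
    using assms by eventually_elim simp
  from mat_holomorphic_at_cong[OF this] mat_holomorphic_at_cong[OF assms]
  show ?thesis by (simp add: mat_simple_pole_def)
qed

lemma mat_residue_cong:
  assumes "\<forall>\<^sub>F z in at t. R z = R' z"
  shows "mat_residue R t = mat_residue R' t"
proof -
  have "residue (\<lambda>z. R z $ i $ j) t = residue (\<lambda>z. R' z $ i $ j) t" for i j
    by (rule residue_cong) (use assms in \<open>auto elim: eventually_mono\<close>)
  then show ?thesis by (simp add: mat_residue_def)
qed

lemma mat_residue_realization:
  "inj p \<Longrightarrow> mat_residue (realization p C B) (p k) = col_times_row (column k C) (row k B)"
  by (simp add: mat_residue_def realization_nth residue_partial_fraction col_times_row_def
      column_def row_def vec_eq_iff)

lemma mat_residue_eq_0_if_holomorphic: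
  assumes "mat_holomorphic_at R t"
  shows "mat_residue R t = 0"
proof -
  have "residue (\<lambda>z. R z $ i $ j) t = 0" for i j
  proof -
    obtain h where h: "h analytic_on {t}" "\<forall>\<^sub>F z in at t. R z $ i $ j = h z"
      using assms unfolding mat_holomorphic_at_def by blast
    have "(\<lambda>z. (z - t) * h z) analytic_on {t}" using h(1) by (intro analytic_intros)
    moreover have "\<forall>\<^sub>F z in at t. (z - t) * R z $ i $ j = (z - t) * h z"
      using h(2) by eventually_elim simp
    ultimately show ?thesis by (rule residue_eq_limit[THEN trans]) simp
  qed
  then show ?thesis by (simp add: mat_residue_def vec_eq_iff)
qed

text \<open>
  The residue at \<open>p k\<close> is the product of a nonzero column and a nonzero row.
\<close>

lemma mat_simple_pole_realization:
  fixes C :: "complex ^ 'n::finite ^ 'm"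
  assumes "inj p" "column k C \<noteq> 0" "row k B \<noteq> 0"
  shows "mat_simple_pole (realization p C B) (p k)"
proof -
  have "mat_residue (realization p C B) (p k) \<noteq> 0"
    using assms by (simp add: mat_residue_realization col_times_row_eq_0_iff)
  then have "\<not> mat_holomorphic_at (realization p C B) (p k)"
    using mat_residue_eq_0_if_holomorphic by blast
  moreover have "mat_holomorphic_at (\<lambda>z. \<chi> i j. (z - p k) * realization p C B z $ i $ j) (p k)"
    unfolding mat_holomorphic_at_def realization_nth
  proof (intro allI exI conjI)
    fix i j
    let ?a = "\<lambda>k. C $ i $ k * B $ k $ j" and ?c = "(mat 1 :: complex ^ 'm ^ 'm) $ i $ j"
    show "(\<lambda>z. ?a k + (z - p k) * partial_fraction ?c (?a(k := 0)) p z) analytic_on {p k}"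
      by (rule partial_fraction_times_linear(1)[OF \<open>inj p\<close>])
    show "\<forall>\<^sub>F z in at (p k). (\<chi> i j. (z - p k) *
        partial_fraction ((mat 1 :: complex ^ 'm ^ 'm) $ i $ j) (\<lambda>k. C $ i $ k * B $ k $ j) p z) $ i $ j =
        ?a k + (z - p k) * partial_fraction ?c (?a(k := 0)) p z"
      using partial_fraction_times_linear(2)[OF \<open>inj p\<close>, of k ?c ?a] by simp
  qed
  ultimately show ?thesis by (simp add: mat_simple_pole_def)
qed

lemma realization_tendsto: "(realization p C B \<longlongrightarrow> mat 1) at_infinity"
  by (intro vec_tendstoI) (simp add: realization_nth partial_fraction_tendsto)

lemma mat_holomorphic_at_realization_infinity: "mat_holomorphic_at (\<lambda>w. realization p C B (1 / w)) 0"
  unfolding mat_holomorphic_at_def realization_nth using partial_fraction_at_infinity by blast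

lemma mat_deriv_realization:
  assumes "z \<notin> range p"
  shows "mat_deriv (realization p C B) z =
    - (C ** diag_mat (\<lambda>k. 1 / (z - p k)) ** diag_mat (\<lambda>k. 1 / (z - p k)) ** B)"
proof -
  have "(C ** diag_mat (\<lambda>k. 1 / (z - p k)) ** diag_mat (\<lambda>k. 1 / (z - p k)) ** B) $ i $ j =
      (\<Sum>k\<in>UNIV. C $ i $ k * B $ k $ j / (z - p k)\<^sup>2)" for i j
    by (subst matrix_mult_nth) (simp add: diag_mat_mult_nth power2_eq_square)
  then show ?thesis
    using DERIV_imp_deriv[OF partial_fraction_deriv[OF assms]]
    by (simp add: mat_deriv_def realization_nth vec_eq_iff)
qed

lemma eventually_at_notin_finite:
  fixes t :: complex
  assumes "finite A"
  shows "\<forall>\<^sub>F z in at t. z \<notin> A"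
  using islimpt_finite[OF assms, of t] by (simp add: islimpt_iff_eventually)

lemma eventually_at_0_inverse_notin_finite:
  fixes A :: "complex set"
  assumes "finite A"
  shows "\<forall>\<^sub>F w in at 0. 1 / w \<notin> A"
proof -
  have "\<forall>\<^sub>F w in at 0. w \<notin> (\<lambda>a. 1 / a) ` A"
    using assms by (intro eventually_at_notin_finite) auto
  then show ?thesis by eventually_elim force
qed

section \<open>Rational functions built from pole and zero data\<close>

text \<open>
  The situation at a single parameter value: \<open>S\<close> is the coupling matrix of \<open>F\<close> and \<open>G\<close>. Columns of
  \<open>F\<close> belong to zeros and rows of \<open>G\<close> to poles, so that exchanging \<open>p\<close> with \<open>q\<close> amounts to passing
  to the inverse function.
\<close>

locale zero_pole_coupling =
  fixes p q :: "'n::finite \<Rightarrow> complex"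
    and F :: "complex ^ 'n ^ 'm" and G :: "complex ^ 'm ^ 'n" and S :: "complex ^ 'n ^ 'n"
  assumes inj_p: "inj p" and inj_q: "inj q" and disjoint: "range p \<inter> range q = {}"
    and invertible_S: "invertible S"
    and sylvester: "diag_mat p ** S - S ** diag_mat q = G ** F"
begin

definition R :: "complex \<Rightarrow> complex ^ 'm ^ 'm" where
  "R = realization p (F ** matrix_inv S) G"

definition R_inv :: "complex \<Rightarrow> complex ^ 'm ^ 'm" where
  "R_inv = realization q (- F) (matrix_inv S ** G)"

lemma sylvester_nth: "(p k - q l) * S $ k $ l = (G ** F) $ k $ l"
proof -
  have "(diag_mat p ** S - S ** diag_mat q) $ k $ l = (G ** F) $ k $ l" by (simp only: sylvester)
  then show ?thesis by (simp add: diag_mat_mult_nth algebra_simps)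
qed

lemma p_neq_q: "p k \<noteq> q l"
  using disjoint by auto

text \<open>
  The \<open>k\<close>-th column of the Lyapunov equation expresses the \<open>k\<close>-th column of \<open>S\<close> through that of
  \<open>F\<close>; since poles and zeros are different, a zero column of \<open>F\<close> would make \<open>S\<close> singular.
\<close>

lemma column_F_nonzero: "column k F \<noteq> 0"
proof
  assume "column k F = 0"
  then have "F $ i $ k = 0" for i by (simp add: column_def vec_eq_iff)
  then have "(p l - q k) * S $ l $ k = 0" for l by (simp add: sylvester_nth matrix_mult_nth)
  then have "S $ l $ k = 0" for l by (metis eq_iff_diff_eq_0 mult_eq_0_iff p_neq_q)
  then have "(matrix_inv S ** S) $ k $ k = 0" by (simp add: matrix_mult_nth)
  then show False by (simp add: matrix_inv_inverse[OF invertible_S] mat_def)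
qed

lemma row_G_nonzero: "row k G \<noteq> 0"
proof
  assume "row k G = 0"
  then have "G $ k $ i = 0" for i by (simp add: row_def vec_eq_iff)
  then have "(p k - q l) * S $ k $ l = 0" for l by (simp add: sylvester_nth matrix_mult_nth)
  then have "S $ k $ l = 0" for l by (metis eq_iff_diff_eq_0 mult_eq_0_iff p_neq_q)
  then have "(S ** matrix_inv S) $ k $ k = 0" by (simp add: matrix_mult_nth)
  then show False by (simp add: matrix_inv_inverse[OF invertible_S] mat_def)
qed

text \<open>
  Multiplying the Lyapunov equation by \<open>S\<^sup>-\<^sup>1\<close> from both sides gives the Lyapunov equation of the
  inverse function, with zeros and poles exchanged. Every statement about \<open>F\<close> and \<open>G\<close> thereby
  becomes one about \<open>F S\<^sup>-\<^sup>1\<close> and \<open>S\<^sup>-\<^sup>1 G\<close>.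
\<close>

lemma dual: "zero_pole_coupling q p (F ** matrix_inv S) (matrix_inv S ** G) (- matrix_inv S)"
proof
  let ?T = "matrix_inv S"
  have T: "S ** ?T = mat 1" "?T ** S = mat 1" by (rule matrix_inv_inverse[OF invertible_S])+
  show "inj q" "inj p" "range q \<inter> range p = {}"
    using inj_p inj_q disjoint by auto
  show "invertible (- ?T)"
    unfolding invertible_def using T by (intro exI[of _ "- S"]) (simp add: matrix_minus_left matrix_minus_right)
  have "?T ** G ** (F ** ?T) = ?T ** (G ** F) ** ?T" by (simp add: matrix_mul_assoc)
  also have "\<dots> = ?T ** diag_mat p ** (S ** ?T) - (?T ** S) ** diag_mat q ** ?T"
    unfolding sylvester[symmetric]
    by (simp only: matrix_diff_ldistrib matrix_diff_rdistrib matrix_mul_assoc)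
  also have "\<dots> = diag_mat q ** (- ?T) - (- ?T) ** diag_mat p"
    by (simp add: T matrix_minus_left matrix_minus_right)
  finally show "diag_mat q ** (- ?T) - (- ?T) ** diag_mat p = ?T ** G ** (F ** ?T)" ..
qed

text \<open>
  Entrywise this is \<open>(p k - q l) / ((z - p k) (z - q l)) = 1 / (z - p k) - 1 / (z - q l)\<close>,
  multiplied by \<open>S $ k $ l\<close>.
\<close>

lemma resolvent_identity:
  assumes "z \<notin> range p" "z \<notin> range q"
  shows "diag_mat (\<lambda>k. 1 / (z - p k)) ** (G ** F) ** diag_mat (\<lambda>k. 1 / (z - q k)) =
    diag_mat (\<lambda>k. 1 / (z - p k)) ** S - S ** diag_mat (\<lambda>k. 1 / (z - q k))"
    (is "?P ** _ ** ?Q = _")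
proof -
  have "(?P ** (G ** F) ** ?Q) $ k $ l = (?P ** S - S ** ?Q) $ k $ l" for k l
  proof -
    have "z - p k \<noteq> 0" "z - q l \<noteq> 0" using assms by auto
    then show ?thesis
      by (simp add: diag_mat_mult_nth sylvester_nth[symmetric] field_simps)
  qed
  then show ?thesis by (simp add: vec_eq_iff)
qed

text \<open>
  In the expanded product the quadratic term contains \<open>P G F Q\<close>; by the resolvent identity it
  cancels against the two linear terms.
\<close>

lemma R_mult_R_inv:
  assumes "z \<notin> range p" "z \<notin> range q"
  shows "R z ** R_inv z = mat 1"
proof -
  let ?T = "matrix_inv S"
  let ?P = "diag_mat (\<lambda>k. 1 / (z - p k))" and ?Q = "diag_mat (\<lambda>k. 1 / (z - q k))"
  have T: "S ** ?T = mat 1" "?T ** S = mat 1" by (rule matrix_inv_inverse[OF invertible_S])+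
  have "F ** ?T ** ?P ** G ** (F ** ?Q ** (?T ** G)) = F ** ?T ** (?P ** (G ** F) ** ?Q) ** ?T ** G"
    by (simp only: matrix_mul_assoc)
  also have "\<dots> = F ** ?T ** ?P ** (S ** ?T) ** G - F ** (?T ** S) ** ?Q ** ?T ** G"
    unfolding resolvent_identity[OF assms] by (simp only: matrix_diff_ldistrib matrix_diff_rdistrib matrix_mul_assoc)
  also have "\<dots> = F ** ?T ** ?P ** G - F ** ?Q ** (?T ** G)"
    by (simp add: T matrix_mul_assoc)
  finally have prod: "F ** ?T ** ?P ** G ** (F ** ?Q ** (?T ** G)) =
    F ** ?T ** ?P ** G - F ** ?Q ** (?T ** G)" .
  have "R z ** R_inv z = (mat 1 + F ** ?T ** ?P ** G) ** (mat 1 - F ** ?Q ** (?T ** G))"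
    by (simp add: R_def R_inv_def realization_def matrix_minus_left)
  also have "\<dots> = mat 1 + F ** ?T ** ?P ** G - F ** ?Q ** (?T ** G)
      - F ** ?T ** ?P ** G ** (F ** ?Q ** (?T ** G))"
    by (simp add: matrix_diff_ldistrib matrix_add_rdistrib algebra_simps)
  finally show ?thesis by (simp add: prod)
qed

lemma matrix_inv_R:
  assumes "z \<notin> range p" "z \<notin> range q"
  shows "matrix_inv (R z) = R_inv z"
  using R_mult_R_inv[OF assms] by (rule matrix_inv_unique)

lemma eventually_inv_fun_R: "\<forall>\<^sub>F z in at t. inv_fun R z = R_inv z"
proof -
  have "\<forall>\<^sub>F z in at t. z \<notin> range p \<union> range q" by (intro eventually_at_notin_finite) auto
  then show ?thesis by eventually_elim (simp add: inv_fun_def matrix_inv_R)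
qed

lemma mat_holomorphic_at_R: "t \<notin> range p \<Longrightarrow> mat_holomorphic_at R t"
  unfolding R_def by (rule mat_holomorphic_at_realization)

lemma mat_holomorphic_at_inv_R: "t \<notin> range q \<Longrightarrow> mat_holomorphic_at (inv_fun R) t"
  using mat_holomorphic_at_cong[OF eventually_inv_fun_R]
  by (simp add: R_inv_def mat_holomorphic_at_realization)

lemma mat_simple_pole_R: "mat_simple_pole R (p k)"
proof -
  have "column k (F ** matrix_inv S) \<noteq> 0"
    using zero_pole_coupling.column_F_nonzero[OF dual] by blast
  then show ?thesis
    unfolding R_def using inj_p row_G_nonzero by (intro mat_simple_pole_realization)
qed

lemma mat_simple_pole_inv_R: "mat_simple_pole (inv_fun R) (q k)"
proof -
  have "row k (matrix_inv S ** G) \<noteq> 0"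
    using zero_pole_coupling.row_G_nonzero[OF dual] by blast
  moreover have "column k (- F) \<noteq> 0"
    using column_F_nonzero[of k] by (simp add: column_def vec_eq_iff)
  ultimately have "mat_simple_pole R_inv (q k)"
    unfolding R_inv_def using inj_q by (intro mat_simple_pole_realization)
  then show ?thesis using mat_simple_pole_cong[OF eventually_inv_fun_R] by blast
qed

lemma simple_pole_point_R_iff: "simple_pole_point R t \<longleftrightarrow> t \<in> range p"
proof
  assume "simple_pole_point R t"
  then show "t \<in> range p"
    using mat_holomorphic_at_R unfolding simple_pole_point_def mat_simple_pole_def by blast
next
  assume "t \<in> range p"
  then show "simple_pole_point R t"
    using disjoint unfolding simple_pole_point_def
    by (auto intro!: mat_simple_pole_R mat_holomorphic_at_inv_R)
qed

lemma simple_zero_point_R_iff: "simple_zero_point R t \<longleftrightarrow> t \<in> range q"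
proof
  assume "simple_zero_point R t"
  then show "t \<in> range q"
    using mat_holomorphic_at_inv_R unfolding simple_zero_point_def mat_simple_pole_def by blast
next
  assume "t \<in> range q"
  then show "simple_zero_point R t"
    using disjoint unfolding simple_zero_point_def
    by (auto intro!: mat_simple_pole_inv_R mat_holomorphic_at_R)
qed

lemma R_tendsto: "(R \<longlongrightarrow> mat 1) at_infinity"
proof -
  have "R = realization p (F ** matrix_inv S) G" by (rule ext) (simp add: R_def)
  then show ?thesis by (simp add: realization_tendsto)
qed

lemma mat_residue_R: "mat_residue R (p k) = col_times_row (column k (F ** matrix_inv S)) (row k G)"
  unfolding R_def using inj_p by (rule mat_residue_realization)

lemma mat_residue_inv_R:
  "mat_residue (inv_fun R) (q k) = col_times_row (column k F) (- row k (matrix_inv S ** G))"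
proof -
  have "mat_residue (inv_fun R) (q k) = mat_residue R_inv (q k)"
    by (rule mat_residue_cong[OF eventually_inv_fun_R])
  also have "\<dots> = col_times_row (column k (- F)) (row k (matrix_inv S ** G))"
    unfolding R_inv_def using inj_q by (rule mat_residue_realization)
  finally show ?thesis by (simp add: col_times_row_def column_def row_def vec_eq_iff)
qed

lemma regular_at_infinity_R: "regular_at_infinity R"
proof -
  have "\<forall>\<^sub>F w in at 0. 1 / w \<notin> range p \<union> range q"
    by (intro eventually_at_0_inverse_notin_finite) auto
  then have "\<forall>\<^sub>F w in at 0. inv_fun (\<lambda>w. R (1 / w)) w = R_inv (1 / w)"
    by eventually_elim (simp add: inv_fun_def matrix_inv_R)
  from mat_holomorphic_at_cong[OF this] show ?thesis
    unfolding regular_at_infinity_def regular_point_def R_def R_inv_def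
    using mat_holomorphic_at_realization_infinity by blast
qed

lemma generic_rational_R: "generic_rational R"
proof -
  have "infinite (UNIV :: complex set)" by (rule infinite_UNIV_char_0)
  then obtain z where z: "z \<notin> range p \<union> range q"
    by (metis UNIV_eq_I finite finite_Un finite_imageI)
  then have "det (R z) * det (R_inv z) = 1"
    using R_mult_R_inv[of z] det_mul[of "R z" "R_inv z"] by simp
  then have "\<exists>z. mat_holomorphic_at R z \<and> det (R z) \<noteq> 0"
    using z mat_holomorphic_at_R[of z] by (metis UnCI mult_zero_left zero_neq_one)
  moreover have "simple_pole_point R t \<or> simple_zero_point R t" if "\<not> regular_point R t" for t
    using that mat_holomorphic_at_R mat_holomorphic_at_inv_R
    unfolding simple_pole_point_R_iff simple_zero_point_R_iff regular_point_def by blast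
  moreover have "rank (mat_residue R t) = 1" if "simple_pole_point R t" for t
  proof -
    obtain k where "t = p k" using \<open>simple_pole_point R t\<close> simple_pole_point_R_iff by blast
    then show ?thesis
      using zero_pole_coupling.column_F_nonzero[OF dual, of k] row_G_nonzero[of k]
      by (simp add: mat_residue_R rank_col_times_row)
  qed
  moreover have "rank (mat_residue (inv_fun R) t) = 1" if "simple_zero_point R t" for t
  proof -
    obtain k where "t = q k" using \<open>simple_zero_point R t\<close> simple_zero_point_R_iff by blast
    then show ?thesis
      using zero_pole_coupling.row_G_nonzero[OF dual, of k] column_F_nonzero[of k]
      by (simp add: mat_residue_inv_R rank_col_times_row)
  qed
  moreover have "mat_rational R" unfolding R_def using inj_p by (rule mat_rational_realization)
  ultimately show ?thesis unfolding generic_rational_def using regular_at_infinity_R by blast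
qed

text \<open>
  The same cancellation as in \<open>R_mult_R_inv\<close>, now applied to \<open>- F S\<^sup>-\<^sup>1 P\<^sup>2 G (I - F Q S\<^sup>-\<^sup>1 G)\<close>.
\<close>

lemma log_derivative_R:
  assumes "z \<notin> range p" "z \<notin> range q"
  shows "mat_deriv R z ** matrix_inv (R z) =
    - (F ** matrix_inv S ** diag_mat (\<lambda>k. 1 / (z - p k)) ** S
        ** diag_mat (\<lambda>k. 1 / (z - q k)) ** matrix_inv S ** G)"
proof -
  let ?T = "matrix_inv S"
  let ?P = "diag_mat (\<lambda>k. 1 / (z - p k))" and ?Q = "diag_mat (\<lambda>k. 1 / (z - q k))"
  have T: "S ** ?T = mat 1" by (rule matrix_inv_inverse(1)[OF invertible_S])
  have "F ** ?T ** ?P ** ?P ** G ** (F ** ?Q ** (?T ** G)) =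
      F ** ?T ** ?P ** (?P ** (G ** F) ** ?Q) ** ?T ** G"
    by (simp only: matrix_mul_assoc)
  also have "\<dots> = F ** ?T ** ?P ** ?P ** (S ** ?T) ** G - F ** ?T ** ?P ** S ** ?Q ** ?T ** G"
    unfolding resolvent_identity[OF assms] by (simp only: matrix_diff_ldistrib matrix_diff_rdistrib matrix_mul_assoc)
  finally have prod: "F ** ?T ** ?P ** ?P ** G ** (F ** ?Q ** (?T ** G)) =
      F ** ?T ** ?P ** ?P ** G - F ** ?T ** ?P ** S ** ?Q ** ?T ** G"
    by (simp add: T)
  have "mat_deriv R z = - (F ** ?T ** ?P ** ?P ** G)"
    unfolding R_def using assms(1) by (rule mat_deriv_realization)
  moreover have "matrix_inv (R z) = mat 1 - F ** ?Q ** (?T ** G)"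
    by (simp add: matrix_inv_R[OF assms] R_inv_def realization_def matrix_minus_left)
  ultimately show ?thesis
    by (simp add: matrix_diff_ldistrib matrix_minus_left prod)
qed

end

section \<open>Reconstruction from semiresidual matrices\<close>

lemma generic_rational_eq_realization:
  fixes C :: "complex ^ 'n::finite ^ 'm"
  assumes gen: "generic_rational R" and "inj p" and poles: "{z. simple_pole_point R z} = range p"
    and lim: "(R \<longlongrightarrow> mat 1) at_infinity"
    and res: "\<And>k. mat_residue R (p k) = col_times_row (column k C) (row k G)"
    and "z \<notin> range p"
  shows "R z = realization p C G z"
proof -
  have hol: "mat_holomorphic_at R t" if "t \<notin> range p" for t
    using gen that poles unfolding generic_rational_def regular_point_def simple_zero_point_def by blast
  have pole: "mat_holomorphic_at (\<lambda>z. \<chi> i j. (z - p k) * R z $ i $ j) (p k)" for k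
    using poles unfolding simple_pole_point_def mat_simple_pole_def by blast
  have "R z $ i $ j = realization p C G z $ i $ j" for i j
  proof -
    have "R z $ i $ j = partial_fraction ((mat 1 :: complex ^ 'm ^ 'm) $ i $ j)
        (\<lambda>k. residue (\<lambda>z. R z $ i $ j) (p k)) p z"
    proof (rule rational_fun_eq_partial_fraction)
      show "rational_fun (\<lambda>z. R z $ i $ j)"
        using gen unfolding generic_rational_def mat_rational_def by blast
      show "((\<lambda>z. R z $ i $ j) \<longlongrightarrow> (mat 1 :: complex ^ 'm ^ 'm) $ i $ j) at_infinity"
        by (intro tendsto_vec_nth lim)
      show "\<exists>h. h analytic_on {w} \<and> (\<forall>\<^sub>F v in at w. R v $ i $ j = h v)" if "w \<notin> range p" for w
        using hol[OF that] unfolding mat_holomorphic_at_def by blast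
      show "\<exists>h. h analytic_on {p k} \<and> (\<forall>\<^sub>F w in at (p k). (w - p k) * R w $ i $ j = h w)" for k
        using pole[of k] unfolding mat_holomorphic_at_def by simp
    qed (use assms in auto)
    moreover have "residue (\<lambda>z. R z $ i $ j) (p k) = C $ i $ k * G $ k $ j" for k
    proof -
      have "mat_residue R (p k) $ i $ j = col_times_row (column k C) (row k G) $ i $ j"
        by (simp only: res)
      then show ?thesis by (simp add: mat_residue_def col_times_row_def column_def row_def)
    qed
    ultimately show ?thesis by (simp add: realization_nth)
  qed
  then show ?thesis by (simp add: vec_eq_iff)
qed

text \<open>
  Multiply \<open>R R\<^sup>-\<^sup>1 = I\<close> by \<open>z - t\<close> and let \<open>z\<close> tend to \<open>t\<close>.
\<close>

lemma mat_mult_residue_inv_eq_0: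
  fixes R :: "complex \<Rightarrow> complex ^ 'm ^ 'm"
  assumes R: "\<And>i j. (\<lambda>z. R z $ i $ j) analytic_on {t}"
    and pole: "mat_simple_pole (inv_fun R) t"
    and inv: "\<forall>\<^sub>F z in at t. invertible (R z)"
  shows "R t ** mat_residue (inv_fun R) t = 0"
proof -
  let ?N = "inv_fun R"
  have hol: "mat_holomorphic_at (\<lambda>z. \<chi> i j. (z - t) * ?N z $ i $ j) t"
    using pole unfolding mat_simple_pole_def by blast
  have lim: "((\<lambda>z. (z - t) * ?N z $ j $ l) \<longlongrightarrow> mat_residue ?N t $ j $ l) (at t)" for j l
  proof -
    obtain h where h: "h analytic_on {t}" "\<forall>\<^sub>F z in at t. (z - t) * ?N z $ j $ l = h z"
      using hol unfolding mat_holomorphic_at_def by auto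
    then have "mat_residue ?N t $ j $ l = h t"
      using residue_eq_limit[OF h] by (simp add: mat_residue_def)
    moreover have "(h \<longlongrightarrow> h t) (at t)"
      using analytic_at_imp_isCont[OF h(1)] by (simp add: isContD)
    ultimately show ?thesis using tendsto_cong[OF h(2)] by simp
  qed
  have "(R t ** mat_residue ?N t) $ i $ l = 0" for i l
  proof -
    have "((\<lambda>z. R z $ i $ j) \<longlongrightarrow> R t $ i $ j) (at t)" for j
      using isContD[OF analytic_at_imp_isCont[OF R[of i j]]] .
    then have "((\<lambda>z. \<Sum>j\<in>UNIV. R z $ i $ j * ((z - t) * ?N z $ j $ l)) \<longlongrightarrow>
        (\<Sum>j\<in>UNIV. R t $ i $ j * mat_residue ?N t $ j $ l)) (at t)"
      by (intro tendsto_sum tendsto_mult lim)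
    moreover have "\<forall>\<^sub>F z in at t. (\<Sum>j\<in>UNIV. R z $ i $ j * ((z - t) * ?N z $ j $ l)) =
        (z - t) * (mat 1 :: complex ^ 'm ^ 'm) $ i $ l"
      using inv
    proof eventually_elim
      case (elim z)
      then have "(R z ** ?N z) $ i $ l = (mat 1 :: complex ^ 'm ^ 'm) $ i $ l"
        by (simp add: inv_fun_def matrix_inv_inverse)
      then show ?case
        by (simp add: matrix_mult_nth sum_distrib_left[symmetric] mult.left_commute)
    qed
    ultimately have "((\<lambda>z. (z - t) * (mat 1 :: complex ^ 'm ^ 'm) $ i $ l) \<longlongrightarrow>
        (R t ** mat_residue ?N t) $ i $ l) (at t)"
      by (simp add: matrix_mult_nth tendsto_cong)
    moreover have "((\<lambda>z. (z - t) * (mat 1 :: complex ^ 'm ^ 'm) $ i $ l) \<longlongrightarrow>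
        (t - t) * (mat 1 :: complex ^ 'm ^ 'm) $ i $ l) (at t)"
      by (intro tendsto_intros)
    ultimately show ?thesis using LIM_unique by force
  qed
  then show ?thesis by (simp add: vec_eq_iff)
qed

text \<open>
  \<open>matrix_inv\<close> is an inverse only where the determinant does not vanish. The zeros of the
  determinant are isolated, since the plane without the poles is connected.
\<close>

lemma eventually_invertible_realization:
  assumes "t \<notin> range p" and "z0 \<notin> range p" "det (realization p C B z0) \<noteq> 0"
  shows "\<forall>\<^sub>F z in at t. invertible (realization p C B z)"
proof (rule ccontr)
  assume not_ev: "\<not> ?thesis"
  let ?A = "- range p"
  let ?f = "\<lambda>z. det (realization p C B z)"
  let ?Z = "{z \<in> ?A. ?f z = 0}"
  have "open ?A" by (intro open_Compl finite_imp_closed) auto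
  have "connected ?A"
    using connected_open_diff_countable[of "UNIV :: complex set" "range p"]
      convex_connected[OF convex_UNIV]
    by (simp add: Compl_eq_Diff_UNIV countable_finite)
  have "?f analytic_on {z}" if "z \<in> ?A" for z
    unfolding det_def using that
    by (intro analytic_on_sum analytic_on_mult analytic_on_prod analytic_on_const realization_analytic) auto
  then have "?f holomorphic_on ?A"
    using analytic_on_analytic_at analytic_imp_holomorphic by blast
  moreover have "t islimpt ?Z"
  proof -
    have "\<forall>\<^sub>F z in at t. z \<in> ?A" using assms(1) eventually_at_notin_finite[of "range p" t] by simp
    have "\<not> (\<forall>\<^sub>F z in at t. z \<notin> ?Z)"
    proof
      assume "\<forall>\<^sub>F z in at t. z \<notin> ?Z"
      with \<open>\<forall>\<^sub>F z in at t. z \<in> ?A\<close> have "\<forall>\<^sub>F z in at t. invertible (realization p C B z)"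
        by eventually_elim (simp add: invertible_det_nz)
      then show False using not_ev by blast
    qed
    then show ?thesis by (simp add: islimpt_iff_eventually)
  qed
  ultimately have "?f z0 = 0"
    using assms(1,2) \<open>open ?A\<close> \<open>connected ?A\<close>
    by (intro analytic_continuation[of ?f ?A ?Z t z0]) auto
  then show False using assms(3) by simp
qed

context zero_pole_coupling
begin

text \<open>
  The \<open>(i, k)\<close> entry of \<open>R'(q k) F = 0\<close> is \<open>F $ i $ k + \<Sum>l. C $ i $ l * (G F) $ l $ k / (q k - p l)\<close>.
  By the Lyapunov equation the sum is minus the entry of \<open>C S\<close>, so all these conditions together are
  \<open>F = C S\<close>.
\<close>

lemma R_unique:
  fixes R' :: "complex \<Rightarrow> complex ^ 'm ^ 'm"
  assumes gen: "generic_rational R'" and poles: "{z. simple_pole_point R' z} = range p"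
    and zeros: "{z. simple_zero_point R' z} = range q"
    and lim: "(R' \<longlongrightarrow> mat 1) at_infinity"
    and res_pole: "\<And>k. \<exists>f. mat_residue R' (p k) = col_times_row f (row k G)"
    and res_zero: "\<And>k. \<exists>g. mat_residue (inv_fun R') (q k) = col_times_row (column k F) g"
    and z: "z \<notin> range p"
  shows "R' z = R z"
proof -
  obtain f where f: "\<And>k. mat_residue R' (p k) = col_times_row (f k) (row k G)"
    using res_pole by metis
  define C :: "complex ^ 'n ^ 'm" where "C = (\<chi> i k. f k $ i)"
  have "column k C = f k" for k by (simp add: C_def column_def vec_eq_iff)
  then have res: "\<And>k. mat_residue R' (p k) = col_times_row (column k C) (row k G)"
    using f by simp
  have eq: "R' w = realization p C G w" if "w \<notin> range p" for w
    using gen inj_p poles lim res that by (rule generic_rational_eq_realization)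
  \<comment> \<open>A point where the determinant does not vanish is needed for invertibility near the zeros.\<close>
  obtain z0 where z0: "mat_holomorphic_at R' z0" "det (R' z0) \<noteq> 0"
    using gen unfolding generic_rational_def by blast
  then have "z0 \<notin> range p"
    using poles unfolding simple_pole_point_def mat_simple_pole_def by blast
  have near: "\<forall>\<^sub>F w in nhds (q k). R' w = realization p C G w" for k
  proof -
    have "open (- range p)" "q k \<in> - range p"
      using p_neq_q by (auto intro!: open_Compl finite_imp_closed) (metis p_neq_q)
    then show ?thesis using eq by (auto simp: eventually_nhds)
  qed
  have kernel: "R' (q k) *v column k F = 0" for k
  proof -
    have "q k \<notin> range p" using disjoint by blast
    have "\<forall>\<^sub>F w in at (q k). invertible (R' w)"
    proof -
      have "\<forall>\<^sub>F w in at (q k). R' w = realization p C G w"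
        using near[of k] by (simp add: eventually_nhds_conv_at)
      moreover have "\<forall>\<^sub>F w in at (q k). invertible (realization p C G w)"
        using \<open>q k \<notin> range p\<close> \<open>z0 \<notin> range p\<close> z0(2) eq[OF \<open>z0 \<notin> range p\<close>]
        by (intro eventually_invertible_realization[of _ _ z0]) auto
      ultimately show ?thesis by eventually_elim simp
    qed
    moreover have "(\<lambda>w. R' w $ i $ j) analytic_on {q k}" for i j
    proof -
      have "\<forall>\<^sub>F w in nhds (q k). R' w $ i $ j = realization p C G w $ i $ j"
        using near[of k] by eventually_elim simp
      then show ?thesis
        using analytic_at_cong[of "\<lambda>w. R' w $ i $ j" "\<lambda>w. realization p C G w $ i $ j" "q k" "q k"]
          realization_analytic[OF \<open>q k \<notin> range p\<close>] by blast
    qed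
    moreover have zero: "simple_zero_point R' (q k)" using zeros by blast
    ultimately have prod: "R' (q k) ** mat_residue (inv_fun R') (q k) = 0"
      unfolding simple_zero_point_def by (intro mat_mult_residue_inv_eq_0) auto
    obtain g where g: "mat_residue (inv_fun R') (q k) = col_times_row (column k F) g"
      using res_zero by blast
    have "rank (mat_residue (inv_fun R') (q k)) = 1"
      using gen zero unfolding generic_rational_def by blast
    \<comment> \<open>A residue of rank one does not vanish, so its row factor can be cancelled.\<close>
    then have "g \<noteq> 0"
      using rank_zero g by (metis col_times_row_eq_0_iff zero_neq_one)
    have "col_times_row (R' (q k) *v column k F) g = R' (q k) ** mat_residue (inv_fun R') (q k)"
      by (simp add: g vec_eq_iff col_times_row_def matrix_mult_nth matrix_vector_mult_def
          sum_distrib_right mult.assoc)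
    then show ?thesis using prod \<open>g \<noteq> 0\<close> by (simp add: col_times_row_eq_0_iff)
  qed
  have "F = C ** S"
  proof -
    have "F $ i $ k = (C ** S) $ i $ k" for i k
    proof -
      have "q k \<notin> range p" using disjoint by blast
      have "realization p C G (q k) ** F = F + C ** diag_mat (\<lambda>l. 1 / (q k - p l)) ** (G ** F)"
        by (simp add: realization_def matrix_add_rdistrib matrix_mul_assoc)
      then have "(realization p C G (q k) ** F) $ i $ k =
          F $ i $ k + (C ** diag_mat (\<lambda>l. 1 / (q k - p l)) ** (G ** F)) $ i $ k"
        by simp
      also have "(C ** diag_mat (\<lambda>l. 1 / (q k - p l)) ** (G ** F)) $ i $ k =
          (\<Sum>l\<in>UNIV. - (C $ i $ l * S $ l $ k))"
      proof -
        have "C $ i $ l * (1 / (q k - p l)) * ((p l - q k) * S $ l $ k) = - (C $ i $ l * S $ l $ k)" for l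
        proof -
          have "q k - p l \<noteq> 0" using p_neq_q[of l k] by auto
          then show ?thesis by (simp add: field_simps)
        qed
        then show ?thesis
          by (subst matrix_mult_nth) (simp only: diag_mat_mult_nth sylvester_nth[symmetric])
      qed
      also have "(realization p C G (q k) ** F) $ i $ k = (R' (q k) *v column k F) $ i"
        by (simp add: eq[OF \<open>q k \<notin> range p\<close>] matrix_mult_nth matrix_vector_mult_def column_def)
      finally show ?thesis using kernel[of k] by (simp add: matrix_mult_nth sum_negf)
    qed
    then show ?thesis by (simp add: vec_eq_iff)
  qed
  then have "F ** matrix_inv S = C"
    using matrix_inv_inverse(1)[OF invertible_S] by (simp add: matrix_mul_assoc[symmetric])
  then show ?thesis using eq[OF z] by (simp add: R_def)
qed

end

section \<open>Coupling functions\<close>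

lemma coupling_unique:
  assumes "t \<in> distinct_coords"
  shows "A_P t ** S - S ** A_Z t = G ** F \<longleftrightarrow>
    S = (\<chi> k l. (G ** F) $ k $ l / (t $ Inl k - t $ Inr l))"
proof -
  have "t $ Inl k - t $ Inr l \<noteq> 0" for k l
    using assms by (auto simp: distinct_coords_def dest: injD)
  moreover have "(A_P t ** S - S ** A_Z t) $ k $ l = (t $ Inl k - t $ Inr l) * S $ k $ l" for k l
    by (simp add: A_P_def A_Z_def diag_mat_mult_nth algebra_simps)
  moreover have "A_P t ** S - S ** A_Z t = G ** F \<longleftrightarrow>
      (\<forall>k l. (A_P t ** S - S ** A_Z t) $ k $ l = (G ** F) $ k $ l)"
    by (simp only: vec_eq_iff)
  ultimately show ?thesis
    by (simp add: vec_eq_iff nonzero_eq_divide_eq mult.commute del: vector_minus_component)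
qed

lemma coupling_eq:
  "t \<in> distinct_coords \<Longrightarrow>
    coupling t F G = (\<chi> k l. (G ** F) $ k $ l / (t $ Inl k - t $ Inr l))"
  unfolding coupling_def by (simp add: coupling_unique)

lemma coupling_sylvester:
  assumes "t \<in> distinct_coords"
  shows "A_P t ** coupling t F G - coupling t F G ** A_Z t = G ** F"
  using coupling_unique[OF assms] coupling_eq[OF assms] by blast

lemma diagonal_mat_eq_diag_mat: "diagonal_mat A \<Longrightarrow> A = diag_mat (\<lambda>k. A $ k $ k)"
  by (simp add: diagonal_mat_def diag_mat_def vec_eq_iff)

text \<open>
  Change of the coupling matrix under a rescaling of the columns of \<open>F\<close> and the rows of \<open>G\<close>. If
  the scaling factors do not vanish, the zeros of its determinant stay the same.
\<close>

lemma coupling_gauge: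
  assumes "t \<in> distinct_coords" "diagonal_mat A" "diagonal_mat B"
  shows "coupling t (F ** A) (B ** G) = B ** coupling t F G ** A"
proof -
  obtain a b where ab: "A = diag_mat a" "B = diag_mat b"
    using assms(2,3) diagonal_mat_eq_diag_mat by blast
  have "B ** G ** (F ** A) = B ** (G ** F) ** A" by (simp add: matrix_mul_assoc)
  then show ?thesis
    by (simp add: coupling_eq[OF assms(1)] ab vec_eq_iff diag_mat_mult_nth)
qed

lemma mat_holomorphic_on_coupling:
  fixes F :: "complex ^ ('n::finite + 'n) \<Rightarrow> complex ^ 'n ^ 'm"
  assumes "open U" "U \<subseteq> distinct_coords" "mat_holomorphic_on F U" "mat_holomorphic_on G U"
  shows "mat_holomorphic_on (\<lambda>t. coupling t (F t) (G t)) U"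
  unfolding mat_holomorphic_on_def
proof (intro allI)
  fix k l
  have "holomorphic_several_on (\<lambda>t. (G t ** F t) $ k $ l) U"
    using mat_holomorphic_on_mult[OF assms(1,4,3)] unfolding mat_holomorphic_on_def by blast
  moreover have "t $ Inl k - t $ Inr l \<noteq> 0" if "t \<in> U" for t
    using assms(2) that by (auto simp: distinct_coords_def dest: injD)
  ultimately have "holomorphic_several_on (\<lambda>t. (G t ** F t) $ k $ l / (t $ Inl k - t $ Inr l)) U"
    by (intro holomorphic_several_on_divide holomorphic_several_on_diff holomorphic_several_on_coord
        \<open>open U\<close>)
  then show "holomorphic_several_on (\<lambda>t. coupling t (F t) (G t) $ k $ l) U"
    by (rule holomorphic_several_on_cong) (use assms(2) in \<open>auto simp: coupling_eq\<close>)
qed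

text \<open>
  Cramer's rule for the system whose solution is the \<open>l\<close>-th column of the inverse. It exhibits the
  entries of the inverse as quotients of polynomials in those of \<open>A\<close>.
\<close>

lemma matrix_inv_nth:
  fixes A :: "complex ^ 'n ^ 'n"
  assumes "det A \<noteq> 0"
  shows "matrix_inv A $ k $ l = det (\<chi> i j. if j = k then (if i = l then 1 else 0) else A $ i $ j) / det A"
proof -
  define b :: "complex ^ 'n" where "b = (\<chi> i. if i = l then 1 else 0)"
  have "A ** matrix_inv A = mat 1"
    using assms by (intro matrix_inv_inverse(1)) (simp add: invertible_det_nz)
  moreover have "A *v column l (matrix_inv A) = column l (A ** matrix_inv A)"
    by (simp add: vec_eq_iff column_def matrix_vector_mult_def matrix_mult_nth)
  ultimately have "A *v column l (matrix_inv A) = b"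
    by (simp add: vec_eq_iff column_def mat_def b_def)
  then have "column l (matrix_inv A) =
      (\<chi> k. det (\<chi> i j. if j = k then b $ i else A $ i $ j) / det A)"
    using cramer[OF assms] by blast
  then have "column l (matrix_inv A) $ k = det (\<chi> i j. if j = k then b $ i else A $ i $ j) / det A"
    by simp
  then show ?thesis by (simp add: column_def b_def cong: if_cong)
qed

lemma mat_holomorphic_on_matrix_inv:
  fixes M :: "complex ^ 'k \<Rightarrow> complex ^ 'n ^ 'n"
  assumes "open U" "mat_holomorphic_on M U" "\<And>t. t \<in> U \<Longrightarrow> det (M t) \<noteq> 0"
  shows "mat_holomorphic_on (\<lambda>t. matrix_inv (M t)) U"
  unfolding mat_holomorphic_on_def
proof (intro allI)
  fix k l
  have "mat_holomorphic_on
      (\<lambda>t. \<chi> i j. if j = k then (if i = l then 1 else 0) else M t $ i $ j) U"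
    unfolding mat_holomorphic_on_def
  proof (intro allI)
    fix i j
    show "holomorphic_several_on
        (\<lambda>t. (\<chi> i j. if j = k then (if i = l then 1 else 0) else M t $ i $ j) $ i $ j) U"
      using assms(1,2) unfolding mat_holomorphic_on_def
      by (cases "j = k"; cases "i = l") (simp_all add: holomorphic_several_on_const)
  qed
  then have "holomorphic_several_on
      (\<lambda>t. det (\<chi> i j. if j = k then (if i = l then 1 else 0) else M t $ i $ j) / det (M t)) U"
    using assms by (intro holomorphic_several_on_divide holomorphic_several_on_det)
  then show "holomorphic_several_on (\<lambda>t. matrix_inv (M t) $ k $ l) U"
    by (rule holomorphic_several_on_cong) (simp add: matrix_inv_nth assms(3))
qed

lemma mat_holomorphic_on_realization:
  fixes C :: "complex ^ 'k \<Rightarrow> complex ^ 'n::finite ^ 'm"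
  assumes "open U" "mat_holomorphic_on C U" "mat_holomorphic_on B U"
    and "\<And>k. holomorphic_several_on (\<lambda>t. p t k) U" "\<And>t. t \<in> U \<Longrightarrow> z \<notin> range (p t)"
  shows "mat_holomorphic_on (\<lambda>t. realization (p t) (C t) (B t) z) U"
  unfolding mat_holomorphic_on_def realization_nth partial_fraction_def
proof (intro allI)
  fix i j
  have "holomorphic_several_on (\<lambda>t. C t $ i $ k * B t $ k $ j / (z - p t k)) U" for k
  proof (intro holomorphic_several_on_divide holomorphic_several_on_mult holomorphic_several_on_diff
        holomorphic_several_on_const)
    show "z - p t k \<noteq> 0" if "t \<in> U" for t using assms(5)[OF that] by auto
  qed (use assms(1-4) in \<open>simp_all add: mat_holomorphic_on_def\<close>)
  then show "holomorphic_several_on (\<lambda>t. (mat 1 :: complex ^ 'm ^ 'm) $ i $ j +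
      (\<Sum>k\<in>UNIV. C t $ i $ k * B t $ k $ j / (z - p t k))) U"
    by (intro holomorphic_several_on_add holomorphic_several_on_sum holomorphic_several_on_const
        \<open>open U\<close>)
qed

lemma diagonal_invertible_nonzero:
  fixes A :: "complex ^ 'n ^ 'n"
  assumes "diagonal_mat A" "invertible A"
  shows "A $ k $ k \<noteq> 0"
proof
  assume "A $ k $ k = 0"
  obtain a where a: "A = diag_mat a" using assms(1) diagonal_mat_eq_diag_mat by blast
  then have "(A ** matrix_inv A) $ k $ k = 0"
    using \<open>A $ k $ k = 0\<close> by (simp add: diag_mat_mult_nth) (simp add: diag_mat_def)
  then show False by (simp add: matrix_inv_inverse[OF assms(2)] mat_def)
qed

text \<open>
  The scalar by which a column of \<open>F\<close> is multiplied can be divided out of the row factor.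
\<close>

lemma left_zero_semiresidual_gauge:
  assumes "left_zero_semiresidual R t F" "diagonal_mat A" "invertible A"
  shows "left_zero_semiresidual R t (F ** A)"
  unfolding left_zero_semiresidual_def
proof
  fix k
  obtain g where g: "mat_residue (inv_fun R) (t $ Inr k) = col_times_row (column k F) g"
    using assms(1) unfolding left_zero_semiresidual_def by blast
  have "A $ k $ k \<noteq> 0" using assms(2,3) by (rule diagonal_invertible_nonzero)
  moreover have "column k (F ** A) $ i = F $ i $ k * A $ k $ k" for i
    by (subst diagonal_mat_eq_diag_mat[OF assms(2)]) (simp add: column_def diag_mat_mult_nth)
  ultimately have "col_times_row (column k F) g = col_times_row (column k (F ** A)) ((1 / A $ k $ k) *s g)"
    by (simp add: vec_eq_iff col_times_row_def column_def)
  with g show "\<exists>g. mat_residue (inv_fun R) (t $ Inr k) = col_times_row (column k (F ** A)) g"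
    by auto
qed

lemma right_pole_semiresidual_gauge:
  assumes "right_pole_semiresidual R t G" "diagonal_mat A" "invertible A"
  shows "right_pole_semiresidual R t (A ** G)"
  unfolding right_pole_semiresidual_def
proof
  fix k
  obtain f where f: "mat_residue R (t $ Inl k) = col_times_row f (row k G)"
    using assms(1) unfolding right_pole_semiresidual_def by blast
  have "A $ k $ k \<noteq> 0" using assms(2,3) by (rule diagonal_invertible_nonzero)
  moreover have "row k (A ** G) $ j = A $ k $ k * G $ k $ j" for j
    by (subst diagonal_mat_eq_diag_mat[OF assms(2)]) (simp add: row_def diag_mat_mult_nth)
  ultimately have "col_times_row f (row k G) = col_times_row ((1 / A $ k $ k) *s f) (row k (A ** G))"
    by (simp add: vec_eq_iff col_times_row_def row_def)
  with f show "\<exists>f. mat_residue R (t $ Inl k) = col_times_row f (row k (A ** G))"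
    by auto
qed

lemma pole_matrix_A_P_iff:
  assumes "t \<in> distinct_coords"
  shows "pole_matrix R (A_P t) \<longleftrightarrow> {z. simple_pole_point R z} = range (\<lambda>k. t $ Inl k)"
proof -
  have "A_P t = diag_mat d \<longleftrightarrow> d = (\<lambda>k. t $ Inl k)" for d
    unfolding A_P_def diag_mat_def by (auto simp: vec_eq_iff fun_eq_iff split: if_splits)
  moreover have "inj (\<lambda>k. t $ Inl k)"
    using assms by (auto simp: distinct_coords_def inj_def)
  ultimately show ?thesis unfolding pole_matrix_def by metis
qed

lemma zero_matrix_A_Z_iff:
  assumes "t \<in> distinct_coords"
  shows "zero_matrix R (A_Z t) \<longleftrightarrow> {z. simple_zero_point R z} = range (\<lambda>k. t $ Inr k)"
proof -
  have "A_Z t = diag_mat d \<longleftrightarrow> d = (\<lambda>k. t $ Inr k)" for d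
    unfolding A_Z_def diag_mat_def by (auto simp: vec_eq_iff fun_eq_iff split: if_splits)
  moreover have "inj (\<lambda>k. t $ Inr k)"
    using assms by (auto simp: distinct_coords_def inj_def)
  ultimately show ?thesis unfolding zero_matrix_def by metis
qed

lemma zero_pole_coupling_coupling:
  assumes "t \<in> distinct_coords" "det (coupling t F G) \<noteq> 0"
  shows "zero_pole_coupling (\<lambda>k. t $ Inl k) (\<lambda>k. t $ Inr k) F G (coupling t F G)"
proof
  show "inj (\<lambda>k. t $ Inl k)" "inj (\<lambda>k. t $ Inr k)"
    "range (\<lambda>k. t $ Inl k) \<inter> range (\<lambda>k. t $ Inr k) = {}"
    using assms(1) by (auto simp: distinct_coords_def inj_def)
  show "invertible (coupling t F G)" using assms(2) by (simp add: invertible_det_nz)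
  show "diag_mat (\<lambda>k. t $ Inl k) ** coupling t F G - coupling t F G ** diag_mat (\<lambda>k. t $ Inr k) = G ** F"
    using coupling_sylvester[OF assms(1)] by (simp add: A_P_def A_Z_def)
qed

lemma mat_deriv_cong:
  assumes "\<forall>\<^sub>F w in nhds z. R w = R' w"
  shows "mat_deriv R z = mat_deriv R' z"
proof -
  have "deriv (\<lambda>w. R w $ i $ j) z = deriv (\<lambda>w. R' w $ i $ j) z" for i j
    by (rule deriv_cong_ev) (use assms in \<open>auto elim: eventually_mono\<close>)
  then show ?thesis by (simp add: mat_deriv_def)
qed

section \<open>The family with prescribed semiresidual matrices\<close>

theorem theorem15p4:
  fixes D :: "(complex ^ ('n::finite + 'n)) set"
    and I :: "'a set"
    and U :: "'a \<Rightarrow> (complex ^ ('n + 'n)) set"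
    and F :: "'a \<Rightarrow> complex ^ ('n + 'n) \<Rightarrow> complex ^ 'n ^ 'm"
    and G :: "'a \<Rightarrow> complex ^ ('n + 'n) \<Rightarrow> complex ^ 'm ^ 'n"
    and S :: "'a \<Rightarrow> complex ^ ('n + 'n) \<Rightarrow> complex ^ 'n ^ 'n"
    and \<Gamma> :: "(complex ^ ('n + 'n)) set"
  assumes "is_domain D" and "D \<subseteq> distinct_coords"
    and "finite I" and "\<And>\<alpha>. \<alpha> \<in> I \<Longrightarrow> open (U \<alpha>)" and "(\<Union>\<alpha>\<in>I. U \<alpha>) = D"
    and "\<And>\<alpha>. \<alpha> \<in> I \<Longrightarrow> mat_holomorphic_on (F \<alpha>) (U \<alpha>)"
    and "\<And>\<alpha>. \<alpha> \<in> I \<Longrightarrow> mat_holomorphic_on (G \<alpha>) (U \<alpha>)"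
    and "\<And>\<alpha> \<beta>. \<alpha> \<in> I \<Longrightarrow> \<beta> \<in> I \<Longrightarrow> U \<alpha> \<inter> U \<beta> \<noteq> {} \<Longrightarrow>
          \<exists>D\<^sub>r D\<^sub>c :: complex ^ ('n + 'n) \<Rightarrow> complex ^ 'n ^ 'n.
            mat_holomorphic_on D\<^sub>r (U \<alpha> \<inter> U \<beta>) \<and> mat_holomorphic_on D\<^sub>c (U \<alpha> \<inter> U \<beta>) \<and>
            (\<forall>t \<in> U \<alpha> \<inter> U \<beta>.
               diagonal_mat (D\<^sub>r t) \<and> invertible (D\<^sub>r t) \<and>
               diagonal_mat (D\<^sub>c t) \<and> invertible (D\<^sub>c t) \<and>
               F \<beta> t = F \<alpha> t ** D\<^sub>c t \<and> G \<beta> t = D\<^sub>r t ** G \<alpha> t)"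
    and "PZ_admissible I U F G"
  defines "S \<equiv> \<lambda>\<alpha> t. coupling t (F \<alpha> t) (G \<alpha> t)"
    and "\<Gamma> \<equiv> PZ_singular_set I U F G"
  shows "\<exists>R :: complex \<Rightarrow> complex ^ ('n + 'n) \<Rightarrow> complex ^ 'm ^ 'm.
    normalized_holomorphic_family (D - \<Gamma>) R \<and> has_semiresiduals I U F G R \<and>
    (\<forall>R'. normalized_holomorphic_family (D - \<Gamma>) R' \<and> has_semiresiduals I U F G R' \<longrightarrow>
       (\<forall>t \<in> D - \<Gamma>. \<forall>z. z \<notin> range (\<lambda>k. t $ Inl k) \<longrightarrow> R' z t = R z t)) \<and>
    (\<forall>\<alpha>\<in>I. \<forall>t \<in> U \<alpha> - \<Gamma>. \<forall>z. z \<notin> range (\<lambda>k. t $ Inl k) \<longrightarrow>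
       R z t = mat 1 +
         F \<alpha> t ** matrix_inv (S \<alpha> t) ** matrix_inv (mat z - A_P t) ** G \<alpha> t) \<and>
    (\<forall>\<alpha>\<in>I. \<forall>t \<in> U \<alpha> - \<Gamma>. \<forall>z. z \<notin> range (($) t) \<longrightarrow>
       mat_deriv (\<lambda>w. R w t) z ** matrix_inv (R z t) =
         - (F \<alpha> t ** matrix_inv (S \<alpha> t) ** matrix_inv (mat z - A_P t) ** S \<alpha> t
             ** matrix_inv (mat z - A_Z t) ** matrix_inv (S \<alpha> t) ** G \<alpha> t))"
proof -
  note distinct = assms(2) and cover = assms(5)
  have U_D: "U \<alpha> \<subseteq> D" if "\<alpha> \<in> I" for \<alpha> using cover that by blast
  have U_distinct: "U \<alpha> \<subseteq> distinct_coords" if "\<alpha> \<in> I" for \<alpha>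
    using U_D[OF that] distinct by blast
  define p where "p = (\<lambda>(t :: complex ^ ('n + 'n)) k. t $ Inl k)"
  define q where "q = (\<lambda>(t :: complex ^ ('n + 'n)) k. t $ Inr k)"
  have gauge: "\<exists>A B. diagonal_mat A \<and> invertible A \<and> diagonal_mat B \<and> invertible B \<and>
      F \<beta> t = F \<alpha> t ** A \<and> G \<beta> t = B ** G \<alpha> t"
    if "\<alpha> \<in> I" "\<beta> \<in> I" "t \<in> U \<alpha>" "t \<in> U \<beta>" for \<alpha> \<beta> t
    using assms(8)[OF that(1,2)] that(3,4) by blast
  have det_S_0: "det (S \<beta> t) = 0"
    if "\<alpha> \<in> I" "\<beta> \<in> I" "t \<in> U \<alpha>" "t \<in> U \<beta>" "det (S \<alpha> t) = 0" for \<alpha> \<beta> t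
  proof -
    obtain A B where AB: "diagonal_mat A" "diagonal_mat B" "F \<beta> t = F \<alpha> t ** A" "G \<beta> t = B ** G \<alpha> t"
      using gauge[OF \<open>\<alpha> \<in> I\<close> \<open>\<beta> \<in> I\<close> \<open>t \<in> U \<alpha>\<close> \<open>t \<in> U \<beta>\<close>] by blast
    have "t \<in> distinct_coords" using U_distinct that by blast
    then have "S \<beta> t = B ** S \<alpha> t ** A"
      unfolding S_def AB(3,4) using AB(1,2) by (rule coupling_gauge)
    then show ?thesis using \<open>det (S \<alpha> t) = 0\<close> by (simp add: det_mul)
  qed
  have \<Gamma>_iff: "t \<in> \<Gamma> \<longleftrightarrow> det (S \<alpha> t) = 0" if "\<alpha> \<in> I" "t \<in> U \<alpha>" for \<alpha> t
    using det_S_0 that unfolding \<Gamma>_def PZ_singular_set_def S_def by blast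
  have S_hol: "mat_holomorphic_on (S \<alpha>) (U \<alpha>)" if "\<alpha> \<in> I" for \<alpha>
    unfolding S_def using assms(4,6,7)[OF that] U_distinct[OF that]
    by (intro mat_holomorphic_on_coupling)
  have domain: "is_domain (D - \<Gamma>)"
  proof (rule is_domain_diff_analytic_hypersurface)
    show "connected D" using assms(1) unfolding is_domain_def by blast
    obtain t0 where "t0 \<in> D" using assms(1) unfolding is_domain_def by blast
    then obtain \<alpha> where "\<alpha> \<in> I" using cover by blast
    then obtain t where "t \<in> U \<alpha>" "det (S \<alpha> t) \<noteq> 0"
      using assms(9) unfolding PZ_admissible_def S_def by blast
    then show "D - \<Gamma> \<noteq> {}" using \<Gamma>_iff \<open>\<alpha> \<in> I\<close> U_D by blast
  next
    fix t assume "t \<in> D"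
    then obtain \<alpha> where \<alpha>: "\<alpha> \<in> I" "t \<in> U \<alpha>" using cover by blast
    then obtain r where r: "r > 0" "ball t r \<subseteq> U \<alpha>"
      using assms(4) by (meson openE)
    have "holomorphic_several_on (\<lambda>t. det (S \<alpha> t)) (U \<alpha>)"
      using assms(4) S_hol \<alpha>(1) by (intro holomorphic_several_on_det)
    then have "holomorphic_several_on (\<lambda>t. det (S \<alpha> t)) (ball t r)"
      using r(2) open_ball by (rule holomorphic_several_on_subset)
    then show "\<exists>r>0. \<exists>f. ball t r \<subseteq> D \<and> holomorphic_several_on f (ball t r) \<and>
        (\<forall>x\<in>ball t r. x \<in> \<Gamma> \<longleftrightarrow> f x = 0)"
      using r U_D[OF \<alpha>(1)] \<Gamma>_iff[OF \<alpha>(1)]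
      by (intro exI[of _ r] conjI exI[of _ "\<lambda>t. det (S \<alpha> t)"]) blast+
  qed
  have data: "zero_pole_coupling (p t) (q t) (F \<alpha> t) (G \<alpha> t) (S \<alpha> t)"
    if "\<alpha> \<in> I" "t \<in> U \<alpha> - \<Gamma>" for \<alpha> t
    unfolding p_def q_def S_def
  proof (rule zero_pole_coupling_coupling)
    show "t \<in> distinct_coords" using that U_distinct by blast
    show "det (coupling t (F \<alpha> t) (G \<alpha> t)) \<noteq> 0" using that \<Gamma>_iff[of \<alpha> t] by (simp add: S_def)
  qed
  define R0 where "R0 = (\<lambda>\<alpha> z t. realization (p t) (F \<alpha> t ** matrix_inv (S \<alpha> t)) (G \<alpha> t) z)"
  have R0_eq: "(\<lambda>z. R0 \<alpha> z t) = zero_pole_coupling.R (p t) (F \<alpha> t) (G \<alpha> t) (S \<alpha> t)"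
    if "\<alpha> \<in> I" "t \<in> U \<alpha> - \<Gamma>" for \<alpha> t
    unfolding R0_def zero_pole_coupling.R_def[OF data[OF that]] by (rule refl)
  \<comment> \<open>Uniqueness makes the local functions agree away from the poles; selecting one chart for each
     parameter fixes the remaining values.\<close>
  define chart where "chart = (\<lambda>t. SOME \<alpha>. \<alpha> \<in> I \<and> t \<in> U \<alpha>)"
  have chart: "chart t \<in> I" "t \<in> U (chart t)" if "t \<in> D" for t
  proof -
    have "\<exists>\<alpha>. \<alpha> \<in> I \<and> t \<in> U \<alpha>" using cover that by blast
    then have "chart t \<in> I \<and> t \<in> U (chart t)" unfolding chart_def by (rule someI_ex)
    then show "chart t \<in> I" "t \<in> U (chart t)" by auto
  qed
  define family where "family = (\<lambda>z t. R0 (chart t) z t)"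
  have generic: "generic_rational (\<lambda>z. family z t) \<and> pole_matrix (\<lambda>z. family z t) (A_P t) \<and>
      zero_matrix (\<lambda>z. family z t) (A_Z t) \<and> ((\<lambda>z. family z t) \<longlongrightarrow> mat 1) at_infinity"
    if "t \<in> D - \<Gamma>" for t
  proof -
    have t: "chart t \<in> I" "t \<in> U (chart t) - \<Gamma>" "t \<in> distinct_coords"
      using that chart distinct by auto
    interpret zero_pole_coupling "p t" "q t" "F (chart t) t" "G (chart t) t" "S (chart t) t"
      using t(1,2) by (rule data)
    have eq: "(\<lambda>z. family z t) = R" unfolding family_def using t(1,2) by (rule R0_eq)
    have pq: "(\<lambda>k. t $ Inl k) = p t" "(\<lambda>k. t $ Inr k) = q t" by (simp_all add: p_def q_def)
    show ?thesis
      unfolding eq pole_matrix_A_P_iff[OF t(3)] zero_matrix_A_Z_iff[OF t(3)] pq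
      using generic_rational_R
      R_tendsto by (auto simp: simple_pole_point_R_iff simple_zero_point_R_iff)
  qed
  have semires: "left_zero_semiresidual (\<lambda>z. family z t) t (F \<alpha> t) \<and>
      right_pole_semiresidual (\<lambda>z. family z t) t (G \<alpha> t)" if "\<alpha> \<in> I" "t \<in> U \<alpha> - \<Gamma>" for \<alpha> t
  proof -
    have "t \<in> D" using that U_D by blast
    then have t: "chart t \<in> I" "t \<in> U (chart t) - \<Gamma>" using chart that by auto
    interpret zero_pole_coupling "p t" "q t" "F (chart t) t" "G (chart t) t" "S (chart t) t"
      using t by (rule data)
    have eq: "(\<lambda>z. family z t) = R" unfolding family_def using t by (rule R0_eq)
    have "left_zero_semiresidual (\<lambda>z. family z t) t (F (chart t) t)"
      using mat_residue_inv_R unfolding left_zero_semiresidual_def eq q_def by blast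
    moreover have "right_pole_semiresidual (\<lambda>z. family z t) t (G (chart t) t)"
      using mat_residue_R unfolding right_pole_semiresidual_def eq p_def by blast
    moreover obtain A B where "diagonal_mat A" "invertible A" "diagonal_mat B" "invertible B"
      "F \<alpha> t = F (chart t) t ** A" "G \<alpha> t = B ** G (chart t) t"
      using gauge[OF t(1) \<open>\<alpha> \<in> I\<close>, of t] t(2) \<open>t \<in> U \<alpha> - \<Gamma>\<close> by blast
    ultimately show ?thesis
      by (simp add: left_zero_semiresidual_gauge right_pole_semiresidual_gauge)
  qed
  have unique: "R' z t = R0 \<alpha> z t"
    if R': "generic_rational (\<lambda>z. R' z t)" "pole_matrix (\<lambda>z. R' z t) (A_P t)"
      "zero_matrix (\<lambda>z. R' z t) (A_Z t)" "((\<lambda>z. R' z t) \<longlongrightarrow> mat 1) at_infinity"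
      "left_zero_semiresidual (\<lambda>z. R' z t) t (F \<alpha> t)"
      "right_pole_semiresidual (\<lambda>z. R' z t) t (G \<alpha> t)"
      and t: "\<alpha> \<in> I" "t \<in> U \<alpha> - \<Gamma>" and z: "z \<notin> range (p t)" for R' \<alpha> t z
  proof -
    interpret zero_pole_coupling "p t" "q t" "F \<alpha> t" "G \<alpha> t" "S \<alpha> t"
      using t by (rule data)
    have dist: "t \<in> distinct_coords" using U_distinct t by blast
    have "R' z t = R z"
    proof (rule R_unique[OF R'(1) _ _ R'(4) _ _ z])
      show "{z. simple_pole_point (\<lambda>z. R' z t) z} = range (p t)"
        using R'(2) by (simp add: pole_matrix_A_P_iff[OF dist] p_def)
      show "{z. simple_zero_point (\<lambda>z. R' z t) z} = range (q t)"
        using R'(3) by (simp add: zero_matrix_A_Z_iff[OF dist] q_def)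
      show "\<exists>f. mat_residue (\<lambda>z. R' z t) (p t k) = col_times_row f (row k (G \<alpha> t))" for k
        using R'(6) by (simp add: right_pole_semiresidual_def p_def)
      show "\<exists>g. mat_residue (inv_fun (\<lambda>z. R' z t)) (q t k) = col_times_row (column k (F \<alpha> t)) g" for k
        using R'(5) by (simp add: left_zero_semiresidual_def q_def)
    qed
    also have "R z = R0 \<alpha> z t" using R0_eq[OF t] by metis
    finally show ?thesis .
  qed
  have family_eq: "family z t = R0 \<alpha> z t" if "\<alpha> \<in> I" "t \<in> U \<alpha> - \<Gamma>" "z \<notin> range (p t)" for \<alpha> t z
    using generic semires that U_D by (intro unique) blast+
  have normalized: "normalized_holomorphic_family (D - \<Gamma>) family"
    unfolding normalized_holomorphic_family_def
  proof (intro conjI ballI allI impI)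
    show "is_domain (D - \<Gamma>)" by (rule domain)
    show "D - \<Gamma> \<subseteq> distinct_coords" using distinct by blast
    fix t0 :: "complex ^ ('n + 'n)" and z assume t0: "t0 \<in> D - \<Gamma>" "z \<notin> range (($) t0)"
    define \<alpha> where "\<alpha> = chart t0"
    have \<alpha>: "\<alpha> \<in> I" "t0 \<in> U \<alpha>" unfolding \<alpha>_def using chart t0 by auto
    \<comment> \<open>The point \<open>z\<close> must stay away from the poles for all parameters in the neighbourhood.\<close>
    define V where "V = U \<alpha> \<inter> (D - \<Gamma>) \<inter> {t. \<forall>k. t $ Inl k \<noteq> z}"
    have "open {t :: complex ^ ('n + 'n). t $ Inl k \<noteq> z}" for k
      by (intro open_Collect_neq continuous_on_const linear_continuous_on bounded_linear_vec_nth)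
    then have "open (\<Inter>k. {t :: complex ^ ('n + 'n). t $ Inl k \<noteq> z})" by (intro open_INT) auto
    moreover have "(\<Inter>k. {t :: complex ^ ('n + 'n). t $ Inl k \<noteq> z}) = {t. \<forall>k. t $ Inl k \<noteq> z}"
      by auto
    ultimately have "open {t :: complex ^ ('n + 'n). \<forall>k. t $ Inl k \<noteq> z}" by simp
    then have "open V"
      unfolding V_def using assms(4)[OF \<alpha>(1)] domain by (intro open_Int) (auto simp: is_domain_def)
    have sub: "V \<subseteq> U \<alpha>" unfolding V_def by blast
    have hol: "mat_holomorphic_on M V" if "mat_holomorphic_on M (U \<alpha>)" for M :: "_ \<Rightarrow> complex ^ 'x ^ 'y"
      using that holomorphic_several_on_subset[OF _ sub \<open>open V\<close>] unfolding mat_holomorphic_on_def by blast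
    have "mat_holomorphic_on (\<lambda>t. R0 \<alpha> z t) V"
      unfolding R0_def
    proof (intro mat_holomorphic_on_realization mat_holomorphic_on_mult mat_holomorphic_on_matrix_inv
        hol[OF assms(6)] hol[OF assms(7)] hol[OF S_hol] \<open>open V\<close> \<alpha>(1))
      show "det (S \<alpha> t) \<noteq> 0" if "t \<in> V" for t
        using that \<Gamma>_iff[OF \<alpha>(1), of t] unfolding V_def by blast
      show "holomorphic_several_on (\<lambda>t. p t k) V" for k
        unfolding p_def using \<open>open V\<close> by (rule holomorphic_several_on_coord)
      show "z \<notin> range (p t)" if "t \<in> V" for t
        using that unfolding V_def p_def by auto
    qed
    then have "mat_holomorphic_on (family z) V"
      unfolding mat_holomorphic_on_def
    proof (intro allI)
      fix i j
      assume "\<forall>i j. holomorphic_several_on (\<lambda>t. R0 \<alpha> z t $ i $ j) V"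
      then have "holomorphic_several_on (\<lambda>t. R0 \<alpha> z t $ i $ j) V" by blast
      moreover have "family z t $ i $ j = R0 \<alpha> z t $ i $ j" if "t \<in> V" for t
      proof -
        have "family z t = R0 \<alpha> z t"
          using that \<alpha>(1) unfolding V_def by (intro family_eq) (auto simp: p_def)
        then show ?thesis by simp
      qed
      ultimately show "holomorphic_several_on (\<lambda>t. family z t $ i $ j) V"
        by (rule holomorphic_several_on_cong)
    qed
    moreover have "t0 \<in> V"
    proof -
      have "t0 $ Inl k \<noteq> z" for k using t0(2) by auto
      then show ?thesis using t0(1) \<alpha>(2) unfolding V_def by simp
    qed
    moreover have "V \<subseteq> D - \<Gamma>" unfolding V_def by (intro le_infI1 Int_lower2)
    ultimately show "\<exists>V. t0 \<in> V \<and> V \<subseteq> D - \<Gamma> \<and> mat_holomorphic_on (family z) V"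
      by (intro exI[of _ V] conjI)
  qed (use generic in auto)
  have has_semires: "has_semiresiduals I U F G family"
    using semires unfolding has_semiresiduals_def \<Gamma>_def by blast
  have formula: "family z t = mat 1 +
      F \<alpha> t ** matrix_inv (S \<alpha> t) ** matrix_inv (mat z - A_P t) ** G \<alpha> t"
    if "\<alpha> \<in> I" "t \<in> U \<alpha> - \<Gamma>" "z \<notin> range (\<lambda>k. t $ Inl k)" for \<alpha> t z
    using that by (simp add: family_eq p_def R0_def realization_def A_P_def matrix_inv_mat_minus_diag)
  have log_derivative: "mat_deriv (\<lambda>w. family w t) z ** matrix_inv (family z t) =
      - (F \<alpha> t ** matrix_inv (S \<alpha> t) ** matrix_inv (mat z - A_P t) ** S \<alpha> t
          ** matrix_inv (mat z - A_Z t) ** matrix_inv (S \<alpha> t) ** G \<alpha> t)"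
    if "\<alpha> \<in> I" "t \<in> U \<alpha> - \<Gamma>" "z \<notin> range (($) t)"
    for \<alpha> and t :: "complex ^ ('n + 'n)" and z
  proof -
    interpret zero_pole_coupling "p t" "q t" "F \<alpha> t" "G \<alpha> t" "S \<alpha> t"
      using that(1,2) by (rule data)
    have z: "z \<notin> range (p t)" "z \<notin> range (q t)" using that(3) by (auto simp: p_def q_def)
    have eq: "family w t = R w" if "w \<notin> range (p t)" for w
      using family_eq[OF \<open>\<alpha> \<in> I\<close> \<open>t \<in> U \<alpha> - \<Gamma>\<close> that] R0_eq[OF \<open>\<alpha> \<in> I\<close> \<open>t \<in> U \<alpha> - \<Gamma>\<close>] by metis
    have "open (- range (p t))" by (intro open_Compl finite_imp_closed) auto
    then have "\<forall>\<^sub>F w in nhds z. family w t = R w"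
      using z(1) eq by (auto simp: eventually_nhds)
    then have "mat_deriv (\<lambda>w. family w t) z = mat_deriv R z" by (rule mat_deriv_cong)
    then show ?thesis
      using log_derivative_R[OF z] z
      by (simp add: eq A_P_def A_Z_def p_def q_def matrix_inv_mat_minus_diag)
  qed
  have uniqueness: "R' z t = family z t"
    if R': "normalized_holomorphic_family (D - \<Gamma>) R'" "has_semiresiduals I U F G R'"
      and t: "t \<in> D - \<Gamma>" and z: "z \<notin> range (\<lambda>k. t $ Inl k)" for R' t z
  proof -
    have chart_t: "chart t \<in> I" "t \<in> U (chart t) - \<Gamma>" using chart t by auto
    have "R' z t = R0 (chart t) z t"
    proof (rule unique)
      show "generic_rational (\<lambda>z. R' z t)" "pole_matrix (\<lambda>z. R' z t) (A_P t)"
        "zero_matrix (\<lambda>z. R' z t) (A_Z t)" "((\<lambda>z. R' z t) \<longlongrightarrow> mat 1) at_infinity"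
        using R'(1) t unfolding normalized_holomorphic_family_def by blast+
      show "left_zero_semiresidual (\<lambda>z. R' z t) t (F (chart t) t)"
        "right_pole_semiresidual (\<lambda>z. R' z t) t (G (chart t) t)"
        using R'(2) chart_t unfolding has_semiresiduals_def \<Gamma>_def by blast+
      show "z \<notin> range (p t)" using z by (simp add: p_def)
    qed (use chart_t in auto)
    then show ?thesis by (simp add: family_def)
  qed
  show ?thesis
    using normalized has_semires uniqueness formula log_derivative
    by (intro exI[of _ family] conjI) blast+
qed

end
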